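(* Let $X=Y^\star$, $P$, $j$, $A$ be as in the context, and suppose that $X$ is a Hilbert space. Let $B_R^P(p_0)$ denote the closed ball in $P$ of radius $R$ around $p_0$. Assume that $p_0\in P$ and $R>0$ are given such that the variational inequality $$\bar x\in X,\qquad\langle A(p,\bar x),x-\bar x\rangle+j(x)-j(\bar x)\ge0\qquad\forall x\in X$$ admits a unique solution $S(p)\in X$ for all $p\in B_R^P(p_0)$, and such that there exist constants $c,C>0$ with $$c\|x_1-x_2\|_X^2\le\langle A(p_0,x_1)-A(p_0,x_2),x_1-x_2\rangle\quad\forall x_1,x_2\in X$$ and $$\|A(p,x)-A(p_0,x)\|_Y\le C\|p-p_0\|_P\quad\forall x\in X\ \ \forall p\in B_R^P(p_0).$$ Write $\bar x_0:=S(p_0)$ and $a_0:=-A(p_0,\bar x_0)$, and suppose that $A$ is Fréchet differentiable in $(p_0,\bar x_0)$ with partial derivatives $A_p\in\mathcal L(P,Y)$ and $A_x\in\mathcal L(X,Y)$. Assume that $A_p$ is surjective. Then the following statements are equivalent: (I) The solution map $S:B_R^P(p_0)\to X$ is strongly Hadamard directionally differentiable in $p_0$ in all directions $q\in P$. (II) The functional $j$ is strongly twice epi-differentiable in $\bar x_0$ for $a_0$. Moreover, if one of these conditions is satisfied, then the following assertions hold. (i) $Q_j^{\bar x_0,a_0}:X\to[0,\infty]$ is proper, weakly lower semicontinuous and positively homogeneous of degree two, and $\mathcal K_j^{\bar x_0,a_0}$ is a pointed cone (i.e., a cone containing $0$). (ii) The directional derivative $y:=S'(p_0;q)\in X$ in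 $p_0$ in a direction $q\in P$ is uniquely characterized by the variational inequality $$y\in X,\qquad\langle A_pq+A_xy,z-y\rangle+\tfrac12Q_j^{\bar x_0,a_0}(z)-\tfrac12Q_j^{\bar x_0,a_0}(y)\ge0\qquad\forall z\in X.$$ Moreover, $$Q_j^{\bar x_0,a_0}(y)=\lim_{t\searrow0}\frac{j(\bar x_0+ty_t)-j(\bar x_0)-t\langle a_0,y_t\rangle}{t^2/2},\qquad\text{where }y_t:=(S(p_0+tq)-\bar x_0)/t.$$ (iii) For every $z\in\mathcal K_j^{\bar x_0,a_0}$ there exists a sequence $\{y_k\}\subset S'(p_0;P):=\{S'(p_0;q):q\in P\}$ with $y_k\to z$ and $Q_j^{\bar x_0,a_0}(y_k)\nearrow Q_j^{\bar x_0,a_0}(z)$ as $k\to\infty$. In particular, $S'(p_0;P)$ is a dense subset of $\mathcal K_j^{\bar x_0,a_0}$.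
   Context: Setting: $Y$ is a (real) Banach space that is reflexive or separable, $X=Y^\star$ is its topological dual, $\langle\cdot,\cdot\rangle$ is the dual pairing between $Y$ and $X$, $P$ is a normed vector space, $j:X\to(-\infty,\infty]$ is proper ($j\not\equiv\infty$, not necessarily convex), $\operatorname{dom}(j)=\{x\in X: j(x)\in\mathbb R\}$, and $A:P\times X\to Y$ is a mapping. Solutions $\bar x$ of the variational inequality lie in $\operatorname{dom}(j)$. Weak-$\star$ second subderivative: for $x\in\operatorname{dom}(j)$, $g\in Y$, $$Q_j^{x,g}(z):=\inf\Big\{\liminf_{n\to\infty}\frac{j(x+t_nz_n)-j(x)-t_n\langle g,z_n\rangle}{t_n^2/2}\ \Big|\ t_n\searrow0,\ z_n\stackrel{\star}{\rightharpoonup}z\Big\},\quad z\in X,$$ and the reduced critical cone is $\mathcal K_j^{x,g}:=\{z\in X: Q_j^{x,g}(z)<+\infty\}$. Positive homogeneity of degree two means $Q(\alpha z)=\alpha^2Q(z)$ for all $\alpha>0$. Solutions $y$ of the variational inequality in (ii) are understood to satisfy $Q_j^{\bar x_0,a_0}(y)<\infty$. $j$ is strongly twice epi-differentiable in $x\in\operatorname{dom}(j)$ for $g\in Y$ if for every $z\in X$ and every $\{t_n\}\subset(0,\infty)$ with $t_n\searrow0$ there is a sequence $z_n\to z$ (in norm) with $Q_j^{x,g}(z)=\lim_{n\to\infty}\frac{j(x+t_nz_n)-j(x)-t_n\langle g,z_n\rangle}{t_n^2/2}$. $S$ is strongly Hadamard directionally differentiable in $p_0$ in the direction $q$ with derivative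 $S'(p_0;q)\in X$ if for every family $\{q_t\}_{0<t<t_0}\subset P$ with $q_t\to q$ as $t\searrow0$ one has $(S(p_0+tq_t)-S(p_0))/t\to S'(p_0;q)$ in $X$ as $t\searrow0$. *)

theory Defs
  imports "HOL-Analysis.Analysis"
begin

text \<open>
  The dual of \<open>'y\<close> is the type \<open>'y \<Rightarrow>\<^sub>L real\<close> with its operator norm; the
  pairing \<open>\<langle>y, x\<rangle>\<close> of \<open>y :: 'y\<close> and \<open>x :: 'y \<Rightarrow>\<^sub>L real\<close> is \<open>blinfun_apply x y\<close>.
\<close>

abbreviation (input) pairing :: "'y::real_normed_vector \<Rightarrow> ('y \<Rightarrow>\<^sub>L real) \<Rightarrow> real"
  where "pairing y x \<equiv> blinfun_apply x y"

definition reflexive_space :: "'y::real_normed_vector itself \<Rightarrow> bool" where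
  "reflexive_space _ \<longleftrightarrow>
     (\<forall>\<phi> :: ('y \<Rightarrow>\<^sub>L real) \<Rightarrow>\<^sub>L real. \<exists>y. \<forall>x. blinfun_apply \<phi> x = pairing y x)"

text \<open>
  The type class \<open>real_inner\<close> cannot be used for a dual space \<open>'y \<Rightarrow>\<^sub>L real\<close>, so being
  a Hilbert space is a property of the given complete norm: it comes from an inner product.
\<close>

definition hilbert_space :: "'a::banach itself \<Rightarrow> bool" where
  "hilbert_space _ \<longleftrightarrow>
     (\<exists>ip :: 'a \<Rightarrow> 'a \<Rightarrow> real. bilinear ip \<and> (\<forall>x y. ip x y = ip y x) \<and>
        (\<forall>x. ip x x = (norm x)\<^sup>2))"

definition weak_topology :: "'a::real_normed_vector topology" where
  "weak_topology =
     topology_generated_by {blinfun_apply f -` U | (f :: 'a \<Rightarrow>\<^sub>L real) U. open U}"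

definition weakly_lsc :: "('a::real_normed_vector \<Rightarrow> ereal) \<Rightarrow> bool" where
  "weakly_lsc f \<longleftrightarrow> (\<forall>a. openin weak_topology {x. a < f x})"

definition weak_star_conv ::
    "(nat \<Rightarrow> ('y::real_normed_vector \<Rightarrow>\<^sub>L real)) \<Rightarrow> ('y \<Rightarrow>\<^sub>L real) \<Rightarrow> bool" where
  "weak_star_conv zs z \<longleftrightarrow> (\<forall>y. (\<lambda>n. pairing y (zs n)) \<longlonglongrightarrow> pairing y z)"

definition proper :: "('a \<Rightarrow> ereal) \<Rightarrow> bool" where
  "proper f \<longleftrightarrow> (\<forall>x. f x \<noteq> -\<infinity>) \<and> (\<exists>x. f x \<noteq> \<infinity>)"

text \<open>
  A solution lies in the effective domain of \<open>f\<close> by definition.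
\<close>

definition solves_vi ::
    "(('y::real_normed_vector \<Rightarrow>\<^sub>L real) \<Rightarrow> 'y) \<Rightarrow> (('y \<Rightarrow>\<^sub>L real) \<Rightarrow> ereal) \<Rightarrow> ('y \<Rightarrow>\<^sub>L real) \<Rightarrow> bool"
  where
  "solves_vi F f x \<longleftrightarrow>
     f x < \<infinity> \<and> (\<forall>z. ereal (pairing (F x) (z - x)) + f z - f x \<ge> 0)"

text \<open>
  Below, \<open>t\<^sub>n\<close> decreasing to zero means positive with limit zero; monotonicity is not required.
\<close>

definition pos_null_seq :: "(nat \<Rightarrow> real) \<Rightarrow> bool" where
  "pos_null_seq t \<longleftrightarrow> (\<forall>n. 0 < t n) \<and> t \<longlonglongrightarrow> 0"

definition second_quotient ::
    "(('y::real_normed_vector \<Rightarrow>\<^sub>L real) \<Rightarrow> ereal) \<Rightarrow> ('y \<Rightarrow>\<^sub>L real) \<Rightarrow> 'y \<Rightarrow>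
     real \<Rightarrow> ('y \<Rightarrow>\<^sub>L real) \<Rightarrow> ereal" where
  "second_quotient j x g t z =
     (j (x + t *\<^sub>R z) - j x - ereal (t * pairing g z)) / ereal (t\<^sup>2 / 2)"

definition second_subderivative ::
    "(('y::real_normed_vector \<Rightarrow>\<^sub>L real) \<Rightarrow> ereal) \<Rightarrow> ('y \<Rightarrow>\<^sub>L real) \<Rightarrow> 'y \<Rightarrow>
     ('y \<Rightarrow>\<^sub>L real) \<Rightarrow> ereal" where
  "second_subderivative j x g z =
     Inf {liminf (\<lambda>n. second_quotient j x g (t n) (zs n)) | t zs.
            pos_null_seq t \<and> weak_star_conv zs z}"

definition reduced_critical_cone ::
    "(('y::real_normed_vector \<Rightarrow>\<^sub>L real) \<Rightarrow> ereal) \<Rightarrow> ('y \<Rightarrow>\<^sub>L real) \<Rightarrow> 'y \<Rightarrow>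
     ('y \<Rightarrow>\<^sub>L real) set" where
  "reduced_critical_cone j x g = {z. second_subderivative j x g z < \<infinity>}"

definition strongly_twice_epi_differentiable ::
    "(('y::real_normed_vector \<Rightarrow>\<^sub>L real) \<Rightarrow> ereal) \<Rightarrow> ('y \<Rightarrow>\<^sub>L real) \<Rightarrow> 'y \<Rightarrow> bool" where
  "strongly_twice_epi_differentiable j x g \<longleftrightarrow>
     (\<forall>z t. pos_null_seq t \<longrightarrow>
        (\<exists>zs. zs \<longlonglongrightarrow> z \<and>
           (\<lambda>n. second_quotient j x g (t n) (zs n)) \<longlonglongrightarrow> second_subderivative j x g z))"

text \<open>
  Only the values of \<open>S\<close> near \<open>p\<^sub>0\<close> and those of \<open>qt\<close> on some interval \<open>0 < t < t\<^sub>0\<close> matter,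
  so a map defined on a ball around \<open>p\<^sub>0\<close> may be extended arbitrarily to a total function.
\<close>

definition has_strong_hadamard_derivative ::
    "('p::real_normed_vector \<Rightarrow> 'x::real_normed_vector) \<Rightarrow> 'p \<Rightarrow> 'p \<Rightarrow> 'x \<Rightarrow> bool" where
  "has_strong_hadamard_derivative S p0 q d \<longleftrightarrow>
     (\<forall>qt. (qt \<longlongrightarrow> q) (at_right 0) \<longrightarrow>
        ((\<lambda>t. (S (p0 + t *\<^sub>R qt t) - S p0) /\<^sub>R t) \<longlongrightarrow> d) (at_right 0))"

definition strong_hadamard_derivative ::
    "('p::real_normed_vector \<Rightarrow> 'x::real_normed_vector) \<Rightarrow> 'p \<Rightarrow> 'p \<Rightarrow> 'x" where
  "strong_hadamard_derivative S p0 q = (THE d. has_strong_hadamard_derivative S p0 q d)"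

end

theory Submission
  imports Defs "HOL-Complex_Analysis.Great_Picard"
begin

text \<open>
  Testing the perturbed inequality at \<open>x\<^sub>0 + t z\<close> bounds the second-order quotient at
  \<open>y\<^sub>t = (S (p\<^sub>0 + t q) - x\<^sub>0) / t\<close> by the quotient at \<open>z\<close> plus \<open>2 \<langle>w\<^sub>t, z - y\<^sub>t\<rangle>\<close>, where
  \<open>w\<^sub>t - (A\<^sub>p q + A\<^sub>x y\<^sub>t)\<close> tends to zero.

  If \<open>y\<^sub>t\<close> converges strongly to \<open>y\<close>, its quotients converge to \<open>Q y\<close>, and \<open>y\<close> solves the
  linearised inequality. As \<open>A\<^sub>p\<close> is surjective, the operator \<open>A\<^sub>x + \<partial>Q/2\<close> is then onto, hence so
  is \<open>\<lambda> A\<^sub>x + \<partial>Q/2\<close> for arbitrarily large \<open>\<lambda>\<close>. The resolvents \<open>y\<^sub>\<lambda>\<close> of a point \<open>z\<close> lie in the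
  range of the derivative, satisfy \<open>Q y\<^sub>\<lambda> \<le> Q z\<close>, converge to \<open>z\<close> when \<open>Q z < \<infinity>\<close>, and carry affine
  minorants of \<open>Q\<close>. This gives density, weak lower semicontinuity and, by a diagonal argument,
  recovery sequences for every \<open>z\<close>.

  Conversely, given recovery sequences, any weak limit of \<open>y\<^sub>t\<close> along a subsequence solves the
  linearised inequality, and the coercivity of \<open>A\<^sub>x\<close> makes the convergence strong; uniqueness of
  that solution yields convergence of the whole family.
\<close>

section \<open>Weak sequential compactness in Hilbert spaces\<close>

text \<open>\<open>hilbert_space\<close> only asserts that some inner product exists, so it enters
  as a parameter, tied to the given norm by \<open>ip_self\<close>.\<close>

locale inner_product_norm =
  fixes ip :: "'a::banach \<Rightarrow> 'a \<Rightarrow> real"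
  assumes ip_bilinear: "bilinear ip"
    and ip_commute: "ip x y = ip y x"
    and ip_self: "ip x x = (norm x)\<^sup>2"
begin

lemma ip_add_left: "ip (x + y) z = ip x z + ip y z"
  and ip_add_right: "ip x (y + z) = ip x y + ip x z"
  and ip_diff_left: "ip (x - y) z = ip x z - ip y z"
  and ip_diff_right: "ip x (y - z) = ip x y - ip x z"
  and ip_scale_left: "ip (r *\<^sub>R x) z = r * ip x z"
  and ip_scale_right: "ip x (r *\<^sub>R z) = r * ip x z"
  using ip_bilinear
  by (simp_all add: bilinear_ladd bilinear_radd bilinear_lsub bilinear_rsub bilinear_lmul
      bilinear_rmul)

text \<open>The norm comes first here, so Cauchy-Schwarz is read off from the squared triangle
  inequality.\<close>

lemma ip_le: "ip x y \<le> norm x * norm y"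
proof -
  have "(norm (x + y))\<^sup>2 \<le> (norm x + norm y)\<^sup>2"
    by (intro power_mono norm_triangle_ineq) simp
  moreover have "(norm (x + y))\<^sup>2 = (norm x)\<^sup>2 + 2 * ip x y + (norm y)\<^sup>2"
    using ip_commute[of x y] by (simp flip: ip_self add: ip_add_left ip_add_right)
  ultimately show ?thesis
    by (simp add: power2_sum)
qed

lemma abs_ip_le: "\<bar>ip x y\<bar> \<le> norm x * norm y"
  using ip_le[of x y] ip_le[of "- 1 *\<^sub>R x" y] by (simp only: ip_scale_left) auto

sublocale ip: bounded_bilinear ip
  by unfold_locales
    (auto simp: ip_add_left ip_add_right ip_scale_left ip_scale_right
      intro!: exI[of _ 1] abs_ip_le)

text \<open>The representing vector minimises the energy \<open>J x = ip x x / 2 - f x\<close> over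
  \<open>V\<close>: minimising sequences are Cauchy, and stationarity of the minimiser reads
  \<open>f v = ip u v\<close>. Linearity is assumed on \<open>V\<close> only, because the lemma is
  also applied to a limit functional that is controlled only there.\<close>

lemma riesz_representation_subspace:
  fixes f :: "'a \<Rightarrow> real"
  assumes V: "subspace V" "closed V"
    and f_add: "\<And>x y. x \<in> V \<Longrightarrow> y \<in> V \<Longrightarrow> f (x + y) = f x + f y"
    and f_scale: "\<And>r x. x \<in> V \<Longrightarrow> f (r *\<^sub>R x) = r * f x"
    and f_le: "\<And>x. x \<in> V \<Longrightarrow> \<bar>f x\<bar> \<le> B * norm x"
  obtains u where "u \<in> V" "\<And>x. x \<in> V \<Longrightarrow> f x = ip u x"
proof -
  define J where "J x = ip x x / 2 - f x" for x
  have J_lower: "- B\<^sup>2 / 2 \<le> J x" if "x \<in> V" for x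
  proof -
    have "0 \<le> (norm x - B)\<^sup>2" by simp
    then show ?thesis
      using f_le[OF that] by (simp add: J_def ip_self power2_diff field_simps)
  qed
  define m where "m = Inf (J ` V)"
  have bdd: "bdd_below (J ` V)"
    using J_lower by (intro bdd_belowI2) auto
  have m_le: "m \<le> J x" if "x \<in> V" for x
    unfolding m_def using bdd that by (auto intro: cInf_lower)
  have "\<exists>x\<in>V. J x < m + 1 / real (Suc n)" for n
  proof -
    have "J ` V \<noteq> {}" using V(1) subspace_0 by blast
    moreover have "Inf (J ` V) < m + 1 / real (Suc n)" by (simp add: m_def)
    ultimately show ?thesis using cInf_lessD[of "J ` V"] by auto
  qed
  then obtain x where xV: "x n \<in> V" and xJ: "J (x n) < m + 1 / real (Suc n)" for n
    by metis
  \<comment> \<open>Parallelogram identity: the midpoint lies in \<open>V\<close>, so its energy is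
    at least \<open>m\<close>.\<close>
  have par: "(norm (a - b))\<^sup>2 \<le> 4 * (J a - m) + 4 * (J b - m)" if "a \<in> V" "b \<in> V" for a b
  proof -
    have mid: "(1/2) *\<^sub>R (a + b) \<in> V"
      using V(1) that by (simp add: subspace_add subspace_scale)
    have f_mid: "f ((1/2) *\<^sub>R (a + b)) = (f a + f b) / 2"
      using that V(1) by (simp add: f_add f_scale subspace_add del: scaleR_add_right scaleR_right_distrib)
    have "J ((1/2) *\<^sub>R (a + b)) = (J a + J b) / 2 - (norm (a - b))\<^sup>2 / 8"
      using that V(1) ip_commute[of a b]
      unfolding J_def f_mid
      by (simp flip: ip_self add: ip_add_left ip_add_right
          ip_diff_left ip_diff_right ip_scale_left ip_scale_right field_simps)
    then show ?thesis
      using m_le[OF mid] by (simp add: field_simps)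
  qed
  have "Cauchy x"
  proof (rule CauchyI)
    fix e :: real
    assume "e > 0"
    then have "0 < e\<^sup>2 / 8" by simp
    then obtain N where N: "1 / real (Suc N) < e\<^sup>2 / 8"
      using nat_approx_posE by blast
    show "\<exists>M. \<forall>m\<ge>M. \<forall>n\<ge>M. norm (x m - x n) < e"
    proof (intro exI allI impI)
      fix p q
      assume "p \<ge> N" "q \<ge> N"
      then have "1 / real (Suc p) \<le> 1 / real (Suc N)" "1 / real (Suc q) \<le> 1 / real (Suc N)"
        by (simp_all add: frac_le)
      then have "J (x p) - m < e\<^sup>2 / 8" "J (x q) - m < e\<^sup>2 / 8"
        using xJ[of p] xJ[of q] N by linarith+
      then have "(norm (x p - x q))\<^sup>2 < e\<^sup>2"
        using par[OF xV xV, of p q] by (simp add: field_simps)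
      then show "norm (x p - x q) < e"
        using \<open>e > 0\<close> by (simp add: power_less_imp_less_base)
    qed
  qed
  then obtain u where u: "x \<longlonglongrightarrow> u"
    by (meson Cauchy_convergent_iff convergent_def)
  have uV: "u \<in> V"
    using closed_sequentially[OF V(2)] xV u by blast
  have "f v = ip u v" if v: "v \<in> V" for v
  proof -
    define d where "d = ip u v - f v"
    \<comment> \<open>The right-hand side is the increment of \<open>J\<close> from \<open>u\<close>
      to \<open>u + r v\<close>; it is nonnegative by passage to the limit along the minimising
      sequence.\<close>
    have quad: "0 \<le> r * d + r\<^sup>2 / 2 * (norm v)\<^sup>2" for r
    proof -
      have "0 \<le> r * (ip (x n) v - f v) + r\<^sup>2 / 2 * (norm v)\<^sup>2 + 1 / real (Suc n)" for n
      proof -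
        have "x n + r *\<^sub>R v \<in> V"
          using V(1) v xV by (simp add: subspace_add subspace_scale)
        then have "m \<le> J (x n + r *\<^sub>R v)" by (rule m_le)
        also have "J (x n + r *\<^sub>R v) = J (x n) + r * (ip (x n) v - f v) + r\<^sup>2 / 2 * (norm v)\<^sup>2"
          using v xV V(1) ip_commute[of v "x n"] ip_self[of v]
          by (simp add: J_def f_add f_scale subspace_scale ip_add_left ip_add_right
              ip_scale_left ip_scale_right algebra_simps power2_eq_square add_divide_distrib)
        finally show ?thesis using xJ[of n] by linarith
      qed
      moreover have "(\<lambda>n. r * (ip (x n) v - f v) + r\<^sup>2 / 2 * (norm v)\<^sup>2 + 1 / real (Suc n))
          \<longlonglongrightarrow> r * d + r\<^sup>2 / 2 * (norm v)\<^sup>2 + 0"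
        unfolding d_def
        by (intro tendsto_intros ip.tendsto u LIMSEQ_Suc[OF lim_1_over_n])
      ultimately show ?thesis
        using LIMSEQ_le_const by fastforce
    qed
    have "d = 0"
    proof (cases "v = 0")
      case True
      then show ?thesis using f_scale[OF v, of 0] by (simp add: d_def ip.zero_right)
    next
      case False
      \<comment> \<open>The quadratic is evaluated at its minimiser
        \<open>r = - d / (norm v)^2\<close>.\<close>
      then have "0 \<le> - (d\<^sup>2 / (norm v)\<^sup>2) / 2"
        using quad[of "- d / (norm v)\<^sup>2"] by (simp add: field_simps power2_eq_square)
      then have "d\<^sup>2 / (norm v)\<^sup>2 \<le> 0" by simp
      then show ?thesis using False by (simp add: divide_le_0_iff)
    qed
    then show ?thesis by (simp add: d_def)
  qed
  with uV that show thesis by blast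
qed

text \<open>
  Only the closed subspace \<open>V\<close> of vectors tested successfully by the subsequence matters: every
  functional acts on it as an element of \<open>V\<close> itself, so no orthogonal complement is needed.
\<close>

lemma bounded_seq_weakly_convergent_subseq:
  fixes x :: "nat \<Rightarrow> 'a"
  assumes bdd: "\<And>n. norm (x n) \<le> M"
  obtains r l where "strict_mono (r :: nat \<Rightarrow> nat)"
    "\<And>f :: 'a \<Rightarrow>\<^sub>L real. (\<lambda>n. f (x (r n))) \<longlonglongrightarrow> f l"
proof -
  have M0: "0 \<le> M" using norm_ge_zero bdd order_trans by blast
  have "norm (ip (x m) (x n)) \<le> M * M" for m n
  proof -
    have "norm (ip (x m) (x n)) \<le> norm (x m) * norm (x n)" using abs_ip_le by simp
    also have "\<dots> \<le> M * M" using bdd M0 by (intro mult_mono) auto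
    finally show ?thesis .
  qed
  note ip_seq_bdd = this
  \<comment> \<open>Diagonal extraction over the countable set \<open>range x\<close>: it suffices
    to test the sequence against its own members.\<close>
  obtain r where r: "strict_mono (r :: nat \<Rightarrow> nat)"
    and conv: "\<And>u. u \<in> range x \<Longrightarrow> \<exists>l. (\<lambda>n. ip u (x (r n))) \<longlonglongrightarrow> l"
  proof (rule function_convergent_subsequence[of "range x" "\<lambda>n u. ip u (x n)" "M * M"])
    show "norm (ip u (x n)) \<le> M * M" if "u \<in> range x" for n u
      using ip_seq_bdd that by auto
  qed auto
  define V where "V = {u. convergent (\<lambda>n. ip u (x (r n)))}"
  have xV: "x n \<in> V" for n
    using conv by (auto simp: V_def convergent_def)
  have V_sub: "subspace V"
    by (rule subspaceI)
      (simp_all add: V_def ip_add_left ip_scale_left ip.zero_left convergent_const convergent_add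
        convergent_mult)
  have V_closed: "closed V"
    unfolding closed_sequential_limits
  proof (intro allI impI, elim conjE)
    fix v u
    assume v: "\<forall>n. v n \<in> V" and vu: "v \<longlonglongrightarrow> u"
    have "Cauchy (\<lambda>n. ip u (x (r n)))"
    proof (rule CauchyI)
      fix e :: real
      assume e: "e > 0"
      define e' where "e' = e / (3 * (M + 1))"
      have e': "e' > 0" "e' * M \<le> e / 3"
        using e M0 by (auto simp: e'_def field_simps)
      obtain k where k: "norm (v k - u) < e'"
        using LIMSEQ_D[OF vu e'(1)] by auto
      have close: "\<bar>ip u (x i) - ip (v k) (x i)\<bar> \<le> e / 3" for i
      proof -
        have "\<bar>ip u (x i) - ip (v k) (x i)\<bar> = \<bar>ip (v k - u) (x i)\<bar>"
          by (simp add: ip_diff_left abs_minus_commute)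
        also have "\<dots> \<le> norm (v k - u) * norm (x i)" by (rule abs_ip_le)
        also have "\<dots> \<le> e' * M"
          using k bdd[of i] e' by (intro mult_mono) auto
        finally show ?thesis using e' by linarith
      qed
      have "Cauchy (\<lambda>n. ip (v k) (x (r n)))"
        using v by (auto simp: V_def Cauchy_convergent_iff)
      then obtain N where N: "\<And>m n. m \<ge> N \<Longrightarrow> n \<ge> N \<Longrightarrow>
          norm (ip (v k) (x (r m)) - ip (v k) (x (r n))) < e / 3"
        using CauchyD[of _ "e / 3"] e by (metis divide_pos_pos zero_less_numeral)
      then show "\<exists>N. \<forall>m\<ge>N. \<forall>n\<ge>N. norm (ip u (x (r m)) - ip u (x (r n))) < e"
      proof (intro exI allI impI)
        fix m n
        assume "m \<ge> N" "n \<ge> N"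
        from N[OF this] show "norm (ip u (x (r m)) - ip u (x (r n))) < e"
          using close[of "r m"] close[of "r n"] unfolding real_norm_def by linarith
      qed
    qed
    then show "u \<in> V" by (simp add: V_def Cauchy_convergent_iff)
  qed
  define L where "L u = lim (\<lambda>n. ip u (x (r n)))" for u
  have L: "(\<lambda>n. ip u (x (r n))) \<longlonglongrightarrow> L u" if "u \<in> V" for u
    using that by (auto simp: V_def L_def convergent_LIMSEQ_iff)
  obtain l where lV: "l \<in> V" and l: "\<And>u. u \<in> V \<Longrightarrow> L u = ip l u"
  proof (rule riesz_representation_subspace[OF V_sub V_closed, of L M])
    fix u v assume u: "u \<in> V" and v: "v \<in> V"
    have "(\<lambda>n. ip (u + v) (x (r n))) \<longlonglongrightarrow> L u + L v"
      unfolding ip_add_left using u v L by (intro tendsto_add) auto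
    then show "L (u + v) = L u + L v"
      using L[OF subspace_add[OF V_sub u v]] LIMSEQ_unique by blast
  next
    fix s u assume u: "u \<in> V"
    have "(\<lambda>n. ip (s *\<^sub>R u) (x (r n))) \<longlonglongrightarrow> s * L u"
      unfolding ip_scale_left using u L by (intro tendsto_mult_left) auto
    then show "L (s *\<^sub>R u) = s * L u"
      using L[OF subspace_scale[OF V_sub u]] LIMSEQ_unique by blast
  next
    fix u assume u: "u \<in> V"
    have "\<bar>ip u (x (r n))\<bar> \<le> M * norm u" for n
      using abs_ip_le[of u "x (r n)"] mult_right_mono[OF bdd[of "r n"], of "norm u"]
      by (simp add: mult.commute)
    then show "\<bar>L u\<bar> \<le> M * norm u"
      using LIMSEQ_le_const2[OF tendsto_rabs[OF L[OF u]]] by blast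
  qed blast
  have "(\<lambda>n. f (x (r n))) \<longlonglongrightarrow> f l" for f :: "'a \<Rightarrow>\<^sub>L real"
  proof -
    obtain v where vV: "v \<in> V" and v: "\<And>u. u \<in> V \<Longrightarrow> blinfun_apply f u = ip v u"
    proof (rule riesz_representation_subspace[OF V_sub V_closed, of "blinfun_apply f" "norm f"])
      show "\<bar>blinfun_apply f u\<bar> \<le> norm f * norm u" for u
        using norm_blinfun[of f u] by simp
    qed (auto simp: blinfun.bilinear_simps)
    \<comment> \<open>Since \<open>v\<close> represents \<open>f\<close> and \<open>l\<close>
      represents \<open>L\<close> on \<open>V\<close>, \<open>f (x (r n)) = ip v (x (r n))\<close>
      tends to \<open>L v = ip l v = f l\<close>.\<close>
    show ?thesis
      using L[OF vV] l[OF vV] v[OF xV] v[OF lV] ip_commute by simp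
  qed
  with r that show thesis by blast
qed

end

section \<open>Weak-star convergent sequences\<close>

text \<open>Uniform boundedness principle by Baire's theorem: the closed sets \<open>E k\<close> of
  points where all functionals are bounded by \<open>k\<close> cover the complete space, so one of
  them contains a ball.\<close>

lemma weak_star_conv_bounded:
  fixes zs :: "nat \<Rightarrow> ('y::banach \<Rightarrow>\<^sub>L real)"
  assumes "weak_star_conv zs z"
  obtains M where "\<And>n. norm (zs n) \<le> M"
proof -
  define E where "E k = {y. \<forall>n. \<bar>zs n y\<bar> \<le> real k}" for k
  have closed_E: "closed (E k)" for k
  proof -
    have "E k = (\<Inter>n. {y. \<bar>zs n y\<bar> \<le> real k})" by (auto simp: E_def)
    moreover have "closed {y. \<bar>zs n y\<bar> \<le> real k}" for n
      by (intro closed_Collect_le continuous_intros)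
    ultimately show ?thesis by auto
  qed
  have cover: "\<Union> (range E) = UNIV"
  proof -
    have "\<exists>k. y \<in> E k" for y
    proof -
      have "Bseq (\<lambda>n. zs n y)"
        using assms by (auto simp: weak_star_conv_def intro: convergent_imp_Bseq convergentI)
      then obtain K where "\<And>n. \<bar>zs n y\<bar> \<le> K"
        by (auto simp: Bseq_def)
      moreover obtain k where "K \<le> real k" using real_arch_simple by blast
      ultimately have "y \<in> E k" unfolding E_def by (auto intro: order_trans)
      then show ?thesis ..
    qed
    then show ?thesis by blast
  qed
  have "\<exists>k. interior (E k) \<noteq> {}"
  proof (rule ccontr)
    assume "\<not> ?thesis"
    then have "euclidean interior_of \<Union> (range E) = {}"
      using closed_E
      by (intro Baire_category_alt) (auto simp: completely_metrizable_space_euclidean)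
    then show False by (simp add: cover)
  qed
  then obtain k a e where e: "e > 0" and ball: "cball a e \<subseteq> E k"
    by (metis equals0I mem_interior_cball)
  have "norm (zs n) \<le> 2 * real k / e" for n
  proof (rule norm_blinfun_bound)
    show "0 \<le> 2 * real k / e" using e by simp
    fix y
    show "norm (zs n y) \<le> 2 * real k / e * norm y"
    proof (cases "y = 0")
      case False
      \<comment> \<open>\<open>u\<close> has norm \<open>e\<close>, so \<open>a\<close> and
        \<open>a + u\<close> both lie in the ball; their difference costs the factor 2.\<close>
      define u where "u = (e / norm y) *\<^sub>R y"
      have "a + u \<in> E k" "a \<in> E k"
        using ball e False by (auto simp: u_def dist_norm)
      then have "\<bar>zs n (a + u)\<bar> \<le> real k" "\<bar>zs n a\<bar> \<le> real k"
        by (auto simp: E_def)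
      then have "\<bar>zs n u\<bar> \<le> 2 * real k"
        by (simp add: blinfun.add_right)
      moreover have "\<bar>zs n u\<bar> = e / norm y * \<bar>zs n y\<bar>"
        using e by (simp add: u_def blinfun.scaleR_right abs_mult)
      ultimately show ?thesis using e False by (simp add: field_simps)
    qed simp
  qed
  with that show thesis by blast
qed

text \<open>The functionals are uniformly bounded, which makes the error
  \<open>zs n (g n - l)\<close> vanish.\<close>

lemma tendsto_weak_star_pairing:
  fixes zs :: "nat \<Rightarrow> ('y::banach \<Rightarrow>\<^sub>L real)"
  assumes zs: "weak_star_conv zs z" and g: "g \<longlonglongrightarrow> l"
  shows "(\<lambda>n. pairing (g n) (zs n)) \<longlonglongrightarrow> pairing l z"
proof -
  obtain M where M: "\<And>n. norm (zs n) \<le> M"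
    using weak_star_conv_bounded[OF zs] by blast
  have "(\<lambda>n. zs n (g n - l)) \<longlonglongrightarrow> 0"
  proof (rule Lim_null_comparison)
    show "\<forall>\<^sub>F n in sequentially. norm (zs n (g n - l)) \<le> M * norm (g n - l)"
      by (intro always_eventually allI order_trans[OF norm_blinfun] mult_right_mono M norm_ge_zero)
    show "(\<lambda>n. M * norm (g n - l)) \<longlonglongrightarrow> 0"
      using g by (intro tendsto_mult_right_zero tendsto_norm_zero) (simp add: LIM_zero)
  qed
  moreover have "(\<lambda>n. zs n l) \<longlonglongrightarrow> z l"
    using zs by (simp add: weak_star_conv_def)
  ultimately have "(\<lambda>n. zs n (g n - l) + zs n l) \<longlonglongrightarrow> 0 + z l"
    by (rule tendsto_add)
  then show ?thesis by (simp add: blinfun.diff_right)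
qed

lemma weak_star_conv_if_tendsto: "zs \<longlonglongrightarrow> z \<Longrightarrow> weak_star_conv zs z"
  unfolding weak_star_conv_def by (intro allI tendsto_intros)

lemma weak_star_conv_scaleR: "weak_star_conv zs z \<Longrightarrow> weak_star_conv (\<lambda>n. r *\<^sub>R zs n) (r *\<^sub>R z)"
  by (simp add: weak_star_conv_def scaleR_blinfun.rep_eq tendsto_mult_left)

section \<open>Variational inequalities with a nonnegative functional\<close>

lemma solves_vi_nonneg_iff:
  assumes F: "\<And>z. 0 \<le> F z"
  shows "solves_vi G F x \<longleftrightarrow>
    F x < \<infinity> \<and> (\<forall>z. F x \<le> F z + ereal (pairing (G x) (z - x)))"
proof -
  have "0 \<le> ereal r + F z - F x \<longleftrightarrow> F x \<le> F z + ereal r" if "F x < \<infinity>" for z r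
    using F[of x] F[of z] that by (cases "F x"; cases "F z") auto
  then show ?thesis by (auto simp: solves_vi_def)
qed

text \<open>Each solution is tested with the other. The finite values of \<open>F\<close> cancel in
  the sum, and coercivity bounds what remains. For \<open>g1 = g2\<close> this is
  uniqueness.\<close>

lemma vi_solution_lipschitz:
  fixes B :: "('y::banach \<Rightarrow>\<^sub>L real) \<Rightarrow>\<^sub>L 'y"
  assumes F: "\<And>z. 0 \<le> F z"
    and coercive: "\<And>h. c * (norm h)\<^sup>2 \<le> pairing (B h) h" and lam: "lam > 0"
    and y1: "solves_vi (\<lambda>y. lam *\<^sub>R B y - g1) F y1"
    and y2: "solves_vi (\<lambda>y. lam *\<^sub>R B y - g2) F y2"
  shows "lam * c * norm (y1 - y2) \<le> norm (g1 - g2)"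
proof -
  define h where "h = y1 - y2"
  have fin: "F y1 < \<infinity>" "F y2 < \<infinity>"
    and ineq: "F y1 \<le> F y2 + ereal (pairing (lam *\<^sub>R B y1 - g1) (y2 - y1))"
      "F y2 \<le> F y1 + ereal (pairing (lam *\<^sub>R B y2 - g2) (y1 - y2))"
    using y1 y2 by (auto simp: solves_vi_nonneg_iff F)
  have "0 \<le> pairing (lam *\<^sub>R B y1 - g1) (y2 - y1) + pairing (lam *\<^sub>R B y2 - g2) (y1 - y2)"
    using fin ineq F[of y1] F[of y2] by (cases "F y1"; cases "F y2") auto
  also have "\<dots> = pairing (g1 - g2) h - lam * pairing (B h) h"
    by (simp add: h_def blinfun.bilinear_simps algebra_simps)
  finally have "lam * pairing (B h) h \<le> pairing (g1 - g2) h" by simp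
  also have "\<dots> \<le> norm (g1 - g2) * norm h"
    using norm_blinfun[of h "g1 - g2"] by (simp add: mult.commute abs_le_iff)
  finally have "lam * pairing (B h) h \<le> norm (g1 - g2) * norm h" .
  moreover have "lam * (c * (norm h)\<^sup>2) \<le> lam * pairing (B h) h"
    using coercive lam by (intro mult_left_mono) auto
  ultimately have "lam * c * norm h * norm h \<le> norm (g1 - g2) * norm h"
    by (simp add: power2_eq_square mult.assoc)
  then show ?thesis
    by (cases "h = 0") (auto simp: h_def mult_le_cancel_right)
qed

text \<open>A solution for \<open>mu\<close> is a fixed point of \<open>x\<close> mapped to
  \<open>T (g - (mu - lam) B x)\<close>, where \<open>T\<close> solves the problem for
  \<open>lam\<close>. By \<open>vi_solution_lipschitz\<close>, \<open>T\<close> has Lipschitz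
  constant \<open>1 / (lam * c)\<close>, so \<open>step\<close> makes this map a
  contraction.\<close>

lemma vi_solvable_step:
  fixes B :: "('y::banach \<Rightarrow>\<^sub>L real) \<Rightarrow>\<^sub>L 'y"
  assumes F: "\<And>z. 0 \<le> F z" and c: "c > 0"
    and coercive: "\<And>h. c * (norm h)\<^sup>2 \<le> pairing (B h) h" and lam: "lam > 0"
    and solvable: "\<And>g. \<exists>y. solves_vi (\<lambda>y. lam *\<^sub>R B y - g) F y"
    and step: "\<bar>mu - lam\<bar> * norm B < lam * c"
  shows "\<exists>y. solves_vi (\<lambda>y. mu *\<^sub>R B y - g) F y"
proof -
  obtain T where T: "\<And>g. solves_vi (\<lambda>y. lam *\<^sub>R B y - g) F (T g)"
    using solvable by metis
  define f where "f x = T (g - (mu - lam) *\<^sub>R B x)" for x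
  define k where "k = \<bar>mu - lam\<bar> * norm B / (lam * c)"
  have "dist (f x) (f y) \<le> k * dist x y" for x y
  proof -
    have "lam * c * norm (f x - f y)
        \<le> norm ((g - (mu - lam) *\<^sub>R B x) - (g - (mu - lam) *\<^sub>R B y))"
      unfolding f_def by (rule vi_solution_lipschitz[OF F coercive lam T T])
    also have "\<dots> = \<bar>mu - lam\<bar> * norm (B (x - y))"
    proof -
      have "(g - (mu - lam) *\<^sub>R B x) - (g - (mu - lam) *\<^sub>R B y) = (- (mu - lam)) *\<^sub>R B (x - y)"
        by (simp add: blinfun.diff_right algebra_simps)
      then show ?thesis by (simp only: norm_scaleR abs_minus_cancel)
    qed
    also have "\<dots> \<le> \<bar>mu - lam\<bar> * (norm B * norm (x - y))"
      by (intro mult_left_mono norm_blinfun) simp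
    finally show ?thesis
      using c lam by (simp add: k_def dist_norm field_simps)
  qed
  moreover have "0 \<le> k" "k < 1"
    using c lam step by (simp_all add: k_def)
  ultimately obtain y where "f y = y"
    using banach_fix_type[of k f] by blast
  then have "solves_vi (\<lambda>z. lam *\<^sub>R B z - (g - (mu - lam) *\<^sub>R B y)) F y"
    using T[of "g - (mu - lam) *\<^sub>R B y"] by (simp add: f_def)
  then have "solves_vi (\<lambda>z. mu *\<^sub>R B z - g) F y"
    by (simp add: solves_vi_def algebra_simps)
  then show ?thesis ..
qed

text \<open>
  Solvability for \<open>lam = 1\<close> and all right-hand sides propagates to \<open>lam = (1 + \<theta>)\<^sup>n\<close>, since the
  admissible step in \<open>vi_solvable_step\<close> is proportional to \<open>lam\<close>. This replaces Minty's theorem,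
  and convexity of \<open>F\<close> is not presupposed.
\<close>

lemma vi_resolvents:
  fixes B :: "('y::banach \<Rightarrow>\<^sub>L real) \<Rightarrow>\<^sub>L 'y"
  assumes F: "\<And>z. 0 \<le> F z" and c: "c > 0"
    and coercive: "\<And>h. c * (norm h)\<^sup>2 \<le> pairing (B h) h"
    and solvable: "\<And>g. \<exists>y. solves_vi (\<lambda>y. B y - g) F y"
  obtains lam y where "\<And>n :: nat. (lam n :: real) > 0" "filterlim lam at_top sequentially"
    "\<And>n. solves_vi (\<lambda>y. lam n *\<^sub>R B (y - z)) F (y n)"
proof -
  define \<theta> where "\<theta> = c / (norm B + 1)"
  have \<theta>: "\<theta> > 0" "\<theta> * norm B < c"
    using c norm_ge_zero[of B] by (auto simp: \<theta>_def field_simps add_pos_nonneg)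
  have all: "\<exists>y. solves_vi (\<lambda>y. (1 + \<theta>) ^ n *\<^sub>R B y - g) F y" for n g
  proof (induction n arbitrary: g)
    case 0
    then show ?case using solvable by simp
  next
    case (Suc n)
    have "(1 + \<theta>) ^ n * (\<theta> * norm B) < (1 + \<theta>) ^ n * c"
      using \<theta> by (intro mult_strict_left_mono zero_less_power) auto
    then have "\<bar>(1 + \<theta>) ^ Suc n - (1 + \<theta>) ^ n\<bar> * norm B < (1 + \<theta>) ^ n * c"
      using \<theta> by (simp add: algebra_simps abs_mult)
    then show ?case
      using \<theta> by (intro vi_solvable_step[OF F c coercive _ Suc.IH]) auto
  qed
  define lam where "lam n = (1 + \<theta>) ^ n" for n :: nat
  \<comment> \<open>The right-hand side \<open>lam n B z\<close> centres the problem at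
    \<open>z\<close>.\<close>
  have "\<exists>y. solves_vi (\<lambda>y. lam n *\<^sub>R B (y - z)) F y" for n
    using all[of n "lam n *\<^sub>R B z"] by (simp add: lam_def blinfun.diff_right scaleR_diff_right)
  then obtain y where "\<And>n. solves_vi (\<lambda>y. lam n *\<^sub>R B (y - z)) F (y n)"
    by metis
  moreover have "lam n > 0" for n
    using \<theta> by (simp add: lam_def)
  moreover have "filterlim lam at_top sequentially"
    unfolding lam_def
  proof (rule filterlim_at_infinity_imp_filterlim_at_top)
    show "filterlim (\<lambda>n. (1 + \<theta>) ^ n) at_infinity sequentially"
      by (rule filterlim_realpow_sequentially_gt1) (use \<theta> in simp)
  qed (use \<theta> in \<open>simp add: zero_less_power\<close>)
  ultimately show thesis using that by blast
qed

section \<open>Limit lemmas\<close>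

text \<open>At stage \<open>n\<close> the witness is chosen for the smallest attainable tolerance
  \<open>1 / Suc k\<close> with \<open>k \<le> n\<close>. The cap \<open>n\<close> keeps
  \<open>A n\<close> finite; \<open>A n\<close> may be empty for early \<open>n\<close>, where the
  choice of \<open>w n\<close> is irrelevant.\<close>

lemma diagonal_selection:
  assumes ex: "\<And>e :: real. e > 0 \<Longrightarrow> \<forall>\<^sub>F n in sequentially. \<exists>w. P n w e"
    and mono: "\<And>n w e e'. P n w e \<Longrightarrow> e \<le> e' \<Longrightarrow> P n w e'"
  obtains w where "\<And>e. e > 0 \<Longrightarrow> \<forall>\<^sub>F n in sequentially. P n (w n) e"
proof -
  define A where "A n = {k. k \<le> n \<and> (\<exists>w. P n w (1 / real (Suc k)))}" for n
  define w where "w n = (SOME w. P n w (1 / real (Suc (Max (A n)))))" for n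
  have "\<forall>\<^sub>F n in sequentially. P n (w n) e" if e: "e > 0" for e
  proof -
    obtain k where k: "1 / real (Suc k) < e"
      using nat_approx_posE[OF e] by blast
    have ex_k: "\<forall>\<^sub>F n in sequentially. \<exists>w. P n w (1 / real (Suc k))"
      by (rule ex) simp
    have "\<forall>\<^sub>F n in sequentially. k \<in> A n"
      using eventually_ge_at_top[of k] ex_k
      by eventually_elim (auto simp: A_def)
    then show ?thesis
    proof eventually_elim
      case (elim n)
      have fin: "finite (A n)" by (auto simp: A_def)
      have "Max (A n) \<in> A n" using fin elim by (intro Max_in) auto
      then have "\<exists>w. P n w (1 / real (Suc (Max (A n))))" by (simp add: A_def)
      then have "P n (w n) (1 / real (Suc (Max (A n))))"
        unfolding w_def by (rule someI_ex)
      moreover have "k \<le> Max (A n)" using fin elim by simp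
      then have "1 / real (Suc (Max (A n))) \<le> 1 / real (Suc k)" by (simp add: frac_le)
      ultimately show ?case using mono k by fastforce
    qed
  qed
  with that show thesis by blast
qed

section \<open>Scaling inequalities near zero\<close>

lemma eventually_at_right_scale:
  assumes "\<forall>\<^sub>F t in at_right (0::real). P t" and "\<alpha> > 0"
  shows "\<forall>\<^sub>F t in at_right 0. P (\<alpha> * t)"
proof -
  have "filterlim (\<lambda>t. \<alpha> * t) (at_right 0) (at_right 0)"
    unfolding filterlim_at using assms(2)
    by (auto intro!: tendsto_eq_intros eventually_at_right_less simp: eventually_at_filter)
  with assms(1) show ?thesis
    by (simp add: filterlim_iff)
qed

text \<open>Here \<open>u\<close> is the upper limit of \<open>h\<close> at zero, encoded as the
  infimum of eventual upper bounds. The hypothesis passes to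
  \<open>u \<le> \<alpha>^2 u + (1 - \<alpha>)^2 b\<close>; division by \<open>1 - \<alpha>\<close>
  gives \<open>(1 + \<alpha>) u \<le> (1 - \<alpha>) b\<close>, and \<alpha> tending to 1 forces
  \<open>u \<le> 0\<close>.\<close>

lemma eventually_less_if_scaling_inequality:
  fixes h :: "real \<Rightarrow> real"
  assumes bdd: "\<forall>\<^sub>F t in at_right 0. \<bar>h t\<bar> \<le> M"
    and ineq: "\<And>\<alpha> e. 0 < \<alpha> \<Longrightarrow> \<alpha> < 1 \<Longrightarrow> e > 0 \<Longrightarrow>
      \<forall>\<^sub>F t in at_right 0. h t \<le> \<alpha>\<^sup>2 * h (\<alpha> * t) + (1 - \<alpha>)\<^sup>2 * b + e"
    and b: "b \<ge> 0" and e: "e > 0"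
  shows "\<forall>\<^sub>F t in at_right 0. h t < e"
proof -
  define U where "U = {m. \<forall>\<^sub>F t in at_right 0. h t \<le> m}"
  define u where "u = Inf U"
  have U_ne: "M \<in> U" unfolding U_def using bdd by (auto elim: eventually_mono)
  have U_low: "- M \<le> m" if "m \<in> U" for m
  proof -
    have "\<forall>\<^sub>F t in at_right (0::real). - M \<le> m"
      using bdd that unfolding U_def mem_Collect_eq by eventually_elim auto
    then show ?thesis by (simp add: eventually_const_iff)
  qed
  have bdd_U: "bdd_below U" by (rule bdd_belowI) (rule U_low)
  have u_le: "u \<le> m" if "m \<in> U" for m
    unfolding u_def by (rule cInf_lower[OF that bdd_U])
  have near: "\<exists>m\<in>U. m < u + d" if "d > 0" for d
    using cInf_lessD[of U "u + d"] U_ne that by (auto simp: u_def)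
  have step: "u \<le> \<alpha>\<^sup>2 * u + (1 - \<alpha>)\<^sup>2 * b" if \<alpha>: "0 < \<alpha>" "\<alpha> < 1" for \<alpha>
  proof (rule field_le_epsilon)
    fix d :: real
    assume d: "d > 0"
    obtain m where m: "m \<in> U" "m < u + d / 2" using near[of "d / 2"] d by auto
    have "\<forall>\<^sub>F t in at_right 0. h (\<alpha> * t) \<le> m"
      using m(1) eventually_at_right_scale[OF _ \<alpha>(1), of "\<lambda>t. h t \<le> m"] by (simp add: U_def)
    moreover have "\<forall>\<^sub>F t in at_right 0. h t \<le> \<alpha>\<^sup>2 * h (\<alpha> * t) + (1 - \<alpha>)\<^sup>2 * b + d / 2"
      using ineq[OF \<alpha>, of "d / 2"] d by simp
    ultimately have "\<forall>\<^sub>F t in at_right 0. h t \<le> \<alpha>\<^sup>2 * m + (1 - \<alpha>)\<^sup>2 * b + d / 2"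
    proof eventually_elim
      case (elim t)
      have "\<alpha>\<^sup>2 * h (\<alpha> * t) \<le> \<alpha>\<^sup>2 * m" using elim(1) by (intro mult_left_mono) auto
      with elim(2) show ?case by simp
    qed
    then have "u \<le> \<alpha>\<^sup>2 * m + (1 - \<alpha>)\<^sup>2 * b + d / 2"
      by (intro u_le) (simp add: U_def)
    also have "\<alpha>\<^sup>2 * m \<le> \<alpha>\<^sup>2 * (u + d / 2)" using m by (intro mult_left_mono) auto
    also have "\<alpha>\<^sup>2 * (u + d / 2) \<le> \<alpha>\<^sup>2 * u + d / 2"
      using \<alpha> d by (simp add: algebra_simps power_le_one mult_left_le_one_le)
    finally show "u \<le> \<alpha>\<^sup>2 * u + (1 - \<alpha>)\<^sup>2 * b + d" by simp
  qed
  have bound: "u \<le> (1 - \<alpha>) * b" if \<alpha>: "0 < \<alpha>" "\<alpha> < 1" for \<alpha>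
  proof -
    have "(1 - \<alpha>) * (u * (1 + \<alpha>)) \<le> (1 - \<alpha>) * ((1 - \<alpha>) * b)"
      using step[OF \<alpha>] by (simp add: algebra_simps power2_eq_square)
    then have *: "u * (1 + \<alpha>) \<le> (1 - \<alpha>) * b" using \<alpha> by simp
    show ?thesis
    proof (cases "u \<le> 0")
      case True
      then show ?thesis using \<alpha> b by (smt (verit) mult_nonneg_nonneg)
    next
      case False
      then have "u \<le> u * (1 + \<alpha>)" using \<alpha> by simp
      then show ?thesis using * by linarith
    qed
  qed
  have "u \<le> 0"
  proof (rule tendsto_lowerbound)
    show "((\<lambda>\<alpha>. (1 - \<alpha>) * b) \<longlongrightarrow> 0) (at_left 1)"
      by (auto intro!: tendsto_eq_intros)
    show "\<forall>\<^sub>F \<alpha> in at_left 1. u \<le> (1 - \<alpha>) * b"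
      using eventually_at_left_real[of 0 1] bound by (auto elim: eventually_mono)
  qed simp
  then obtain m where "m \<in> U" "m < e" using near[OF e] by auto
  then show ?thesis by (auto simp: U_def elim: eventually_mono)
qed

text \<open>
  The hypothesis with \<open>\<alpha> > 1\<close> bounds \<open>f\<close> from below and the one with \<open>\<alpha> < 1\<close> from above; both
  bounds close up as \<open>\<alpha> \<rightarrow> 1\<close> because \<open>\<alpha>\<^sup>2 - 1 - 2 (\<alpha> - 1) = (\<alpha> - 1)\<^sup>2\<close> is of second order.
\<close>

lemma tendsto_if_scaling_inequality:
  fixes f :: "real \<Rightarrow> real"
  assumes bdd: "\<forall>\<^sub>F t in at_right 0. \<bar>f t\<bar> \<le> M"
    and ineq: "\<And>\<alpha> e. 0 < \<alpha> \<Longrightarrow> e > 0 \<Longrightarrow>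
      \<forall>\<^sub>F t in at_right 0. f t \<le> \<alpha>\<^sup>2 * f (\<alpha> * t) + 2 * (\<alpha> - 1) * b + e"
  shows "(f \<longlongrightarrow> - b) (at_right 0)"
proof -
  define h where "h t = f t + b" for t
  have bdd_h: "\<forall>\<^sub>F t in at_right 0. \<bar>h t\<bar> \<le> M + \<bar>b\<bar>"
    using bdd by eventually_elim (auto simp: h_def)
  have ineq_h: "\<forall>\<^sub>F t in at_right 0. h t \<le> \<alpha>\<^sup>2 * h (\<alpha> * t) + (1 - \<alpha>)\<^sup>2 * \<bar>b\<bar> + e"
    if "0 < \<alpha>" "e > 0" for \<alpha> e
    using ineq[OF that]
  proof eventually_elim
    case (elim t)
    have "(1 - \<alpha>)\<^sup>2 * (- b) \<le> (1 - \<alpha>)\<^sup>2 * \<bar>b\<bar>" by (intro mult_left_mono) auto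
    with elim show ?case by (simp add: h_def algebra_simps power2_eq_square)
  qed
  have upper: "\<forall>\<^sub>F t in at_right 0. h t < e" if "e > 0" for e
    using ineq_h that by (intro eventually_less_if_scaling_inequality[OF bdd_h, of "\<bar>b\<bar>"]) auto
  have lower: "\<forall>\<^sub>F t in at_right 0. - h t < e" if "e > 0" for e
  proof (rule eventually_less_if_scaling_inequality[of "\<lambda>t. - h t" "M + \<bar>b\<bar>" "\<bar>b\<bar>"])
    \<comment> \<open>The inequality with factor \<open>1 / \<beta>\<close> is used at
      \<open>\<beta> t\<close>; multiplied by \<open>\<beta>^2\<close> it bounds \<open>h t\<close>
      from below, with \<open>\<beta>^2 (1 - 1/\<beta>)^2 = (1 - \<beta>)^2\<close>.\<close>
    fix \<beta> d :: real
    assume \<beta>: "0 < \<beta>" "\<beta> < 1" and d: "d > 0"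
    have "\<forall>\<^sub>F t in at_right 0. h (\<beta> * t) \<le> (1 / \<beta>)\<^sup>2 * h ((1 / \<beta>) * (\<beta> * t))
        + (1 - 1 / \<beta>)\<^sup>2 * \<bar>b\<bar> + d"
      using \<beta> d by (intro eventually_at_right_scale[OF ineq_h]) auto
    then show "\<forall>\<^sub>F t in at_right 0. - h t \<le> \<beta>\<^sup>2 * - h (\<beta> * t) + (1 - \<beta>)\<^sup>2 * \<bar>b\<bar> + d"
    proof eventually_elim
      case (elim t)
      have "\<beta>\<^sup>2 * h (\<beta> * t) \<le> \<beta>\<^sup>2 * ((1 / \<beta>)\<^sup>2 * h t + (1 - 1 / \<beta>)\<^sup>2 * \<bar>b\<bar> + d)"
        using elim \<beta> by (intro mult_left_mono) auto
      also have "\<dots> = h t + (1 - \<beta>)\<^sup>2 * \<bar>b\<bar> + \<beta>\<^sup>2 * d"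
        using \<beta> by (simp add: field_simps power2_eq_square)
      also have "\<beta>\<^sup>2 * d \<le> d"
        using \<beta> d by (simp add: power_le_one mult_left_le_one_le)
      finally show ?case by simp
    qed
  qed (use bdd_h that in auto)
  show ?thesis
  proof (rule tendstoI)
    fix e :: real
    assume "e > 0"
    from upper[OF this] lower[OF this] show "\<forall>\<^sub>F t in at_right 0. dist (f t) (- b) < e"
      by eventually_elim (auto simp: h_def dist_real_def)
  qed
qed

lemma tendsto_if_subseqs:
  fixes f :: "nat \<Rightarrow> 'a::metric_space"
  assumes "\<And>s. strict_mono (s :: nat \<Rightarrow> nat) \<Longrightarrow> \<exists>r. strict_mono (r :: nat \<Rightarrow> nat) \<and> (\<lambda>n. f (s (r n))) \<longlonglongrightarrow> l"
  shows "f \<longlonglongrightarrow> l"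
proof (rule ccontr)
  assume "\<not> f \<longlonglongrightarrow> l"
  then obtain e where e: "e > 0" and "\<not> (\<forall>\<^sub>F n in sequentially. dist (f n) l < e)"
    by (auto simp: tendsto_iff)
  then have "\<exists>\<^sub>F n in sequentially. dist (f n) l \<ge> e"
    by (simp add: frequently_def not_le)
  then have inf: "infinite {n. dist (f n) l \<ge> e}"
    by (simp add: frequently_cofinite cofinite_eq_sequentially[symmetric])
  let ?s = "enumerate {n. dist (f n) l \<ge> e}"
  obtain r where r: "(\<lambda>n. f (?s (r n))) \<longlonglongrightarrow> l"
    using assms[of ?s] strict_mono_enumerate[OF inf] by blast
  have far: "dist (f (?s (r n))) l \<ge> e" for n
    using enumerate_in_set[OF inf] by simp
  have "\<forall>\<^sub>F n in sequentially. False"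
    using tendstoD[OF r e] by (rule eventually_mono) (use far not_le in blast)
  then show False by simp
qed

text \<open>A monotone subsequence exists. If it decreases, it stays above its limit
  \<open>l\<close>, hence is constant by \<open>le\<close>.\<close>

lemma incseq_subseq_if_le_limit:
  fixes a :: "nat \<Rightarrow> ereal"
  assumes lim: "a \<longlonglongrightarrow> l" and le: "\<And>n. a n \<le> l"
  obtains r where "strict_mono (r :: nat \<Rightarrow> nat)" "incseq (\<lambda>n. a (r n))"
proof -
  obtain r where r: "strict_mono (r :: nat \<Rightarrow> nat)" and mono: "monoseq (\<lambda>n. a (r n))"
    using seq_monosub by blast
  have lim_r: "(\<lambda>n. a (r n)) \<longlonglongrightarrow> l"
    using LIMSEQ_subseq_LIMSEQ[OF lim r] by (simp add: o_def)
  have "incseq (\<lambda>n. a (r n))"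
  proof (cases "incseq (\<lambda>n. a (r n))")
    case False
    then have dec: "decseq (\<lambda>n. a (r n))" using mono by (auto simp: monoseq_iff)
    have "l \<le> a (r n)" for n
      using decseq_ge[OF dec lim_r] .
    then have "a (r n) = l" for n using le by (auto intro: antisym)
    then show ?thesis by (simp add: incseq_def)
  qed
  with r that show thesis by blast
qed

section \<open>Second-order difference quotients\<close>

lemma pos_null_seq_filterlim: "pos_null_seq t \<Longrightarrow> filterlim t (at_right 0) sequentially"
  unfolding pos_null_seq_def filterlim_at
  by (auto intro!: always_eventually) (metis less_irrefl)

lemma pos_null_seq_inverse_Suc: "pos_null_seq (\<lambda>n. 1 / real (Suc n))"
  using LIMSEQ_Suc[OF lim_1_over_n] by (simp add: pos_null_seq_def)

lemma pos_null_seq_scale: "pos_null_seq t \<Longrightarrow> r > 0 \<Longrightarrow> pos_null_seq (\<lambda>n. r * t n)"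
  by (auto simp: pos_null_seq_def intro: tendsto_mult_right_zero)

lemma pos_null_seq_subseq: "pos_null_seq t \<Longrightarrow> strict_mono r \<Longrightarrow> pos_null_seq (\<lambda>n. t (r n))"
  using LIMSEQ_subseq_LIMSEQ[of t 0 r] by (auto simp: pos_null_seq_def o_def)

lemma second_quotient_real:
  assumes "j x = ereal r" "j (x + t *\<^sub>R z) = ereal s" "t > 0"
  shows "second_quotient j x g t z = ereal ((s - r - t * pairing g z) / (t\<^sup>2 / 2))"
  using assms by (simp add: second_quotient_def)

lemma second_quotient_PInfty:
  assumes "j x = ereal r" "j (x + t *\<^sub>R z) = \<infinity>" "t > 0"
  shows "second_quotient j x g t z = \<infinity>"
  using assms by (simp add: second_quotient_def)

text \<open>Both quotients evaluate \<open>j\<close> at the same point; only the denominators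
  differ.\<close>

lemma second_quotient_scale:
  assumes "proper j" and jx: "j x = ereal r" and t: "t > 0" and \<alpha>: "\<alpha> > 0"
  shows "second_quotient j x g t (\<alpha> *\<^sub>R z) = ereal (\<alpha>\<^sup>2) * second_quotient j x g (\<alpha> * t) z"
proof -
  have eq: "x + t *\<^sub>R (\<alpha> *\<^sub>R z) = x + (\<alpha> * t) *\<^sub>R z" by (simp add: mult.commute)
  show ?thesis
  proof (cases "j (x + (\<alpha> * t) *\<^sub>R z)")
    case (real s)
    then show ?thesis
      using second_quotient_real[of j x r t "\<alpha> *\<^sub>R z" s g]
        second_quotient_real[of j x r "\<alpha> * t" z s g] jx t \<alpha>
      unfolding eq by (simp add: blinfun.scaleR_left scaleR_blinfun.rep_eq field_simps power2_eq_square)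
  next
    case PInf
    then show ?thesis
      using second_quotient_PInfty[of j x r t "\<alpha> *\<^sub>R z" g]
        second_quotient_PInfty[of j x r "\<alpha> * t" z g] jx t \<alpha>
      unfolding eq by simp
  next
    case MInf
    then show ?thesis using \<open>proper j\<close> by (simp add: proper_def)
  qed
qed

lemma second_subderivative_le_liminf:
  assumes "pos_null_seq t" "weak_star_conv zs z"
  shows "second_subderivative j x g z \<le> liminf (\<lambda>n. second_quotient j x g (t n) (zs n))"
  unfolding second_subderivative_def by (rule Inf_lower) (use assms in blast)

text \<open>An admissible pair \<open>(t, zs)\<close> for \<open>z\<close> becomes the admissible
  pair \<open>(t / \<alpha>, \<alpha> zs)\<close> for \<open>\<alpha> z\<close>.\<close>

lemma second_subderivative_scale_le:
  assumes "proper j" "j x = ereal r" and \<alpha>: "\<alpha> > 0"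
  shows "second_subderivative j x g (\<alpha> *\<^sub>R z) \<le> ereal (\<alpha>\<^sup>2) * second_subderivative j x g z"
proof -
  have "ereal (1 / \<alpha>\<^sup>2) * second_subderivative j x g (\<alpha> *\<^sub>R z) \<le> second_subderivative j x g z"
    unfolding second_subderivative_def[of j x g z]
  proof (intro Inf_greatest, clarify)
    fix t zs
    assume t: "pos_null_seq t" and zs: "weak_star_conv zs z"
    have "second_subderivative j x g (\<alpha> *\<^sub>R z)
        \<le> liminf (\<lambda>n. second_quotient j x g (1 / \<alpha> * t n) (\<alpha> *\<^sub>R zs n))"
      using t zs \<alpha>
      by (intro second_subderivative_le_liminf pos_null_seq_scale weak_star_conv_scaleR) auto
    also have "\<dots> = liminf (\<lambda>n. ereal (\<alpha>\<^sup>2) * second_quotient j x g (t n) (zs n))"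
    proof -
      have "1 / \<alpha> * t n > 0" for n using t \<alpha> by (simp add: pos_null_seq_def)
      then show ?thesis
        using \<alpha> by (simp only: second_quotient_scale[OF assms(1,2) _ \<alpha>]) (simp add: field_simps)
    qed
    also have "\<dots> = ereal (\<alpha>\<^sup>2) * liminf (\<lambda>n. second_quotient j x g (t n) (zs n))"
      by (intro Liminf_ereal_mult_left) auto
    finally have "ereal (1 / \<alpha>\<^sup>2) * second_subderivative j x g (\<alpha> *\<^sub>R z)
        \<le> ereal (1 / \<alpha>\<^sup>2) * (ereal (\<alpha>\<^sup>2) * liminf (\<lambda>n. second_quotient j x g (t n) (zs n)))"
      by (intro ereal_mult_left_mono) auto
    also have "\<dots> = liminf (\<lambda>n. second_quotient j x g (t n) (zs n))"
      using \<alpha> by (simp flip: mult.assoc)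
    finally show "ereal (1 / \<alpha>\<^sup>2) * second_subderivative j x g (\<alpha> *\<^sub>R z)
        \<le> liminf (\<lambda>n. second_quotient j x g (t n) (zs n))" .
  qed
  then have "ereal (\<alpha>\<^sup>2) * (ereal (1 / \<alpha>\<^sup>2) * second_subderivative j x g (\<alpha> *\<^sub>R z))
      \<le> ereal (\<alpha>\<^sup>2) * second_subderivative j x g z"
    by (intro ereal_mult_left_mono) auto
  then show ?thesis using \<alpha> by (simp flip: mult.assoc)
qed

text \<open>The reverse inequality is the one-sided one with factor \<open>1 / \<alpha>\<close> at
  \<open>\<alpha> z\<close>.\<close>

lemma second_subderivative_scale:
  assumes "proper j" "j x = ereal r" and \<alpha>: "\<alpha> > 0"
  shows "second_subderivative j x g (\<alpha> *\<^sub>R z) = ereal (\<alpha>\<^sup>2) * second_subderivative j x g z"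
proof (rule antisym)
  have "second_subderivative j x g ((1 / \<alpha>) *\<^sub>R (\<alpha> *\<^sub>R z))
      \<le> ereal ((1 / \<alpha>)\<^sup>2) * second_subderivative j x g (\<alpha> *\<^sub>R z)"
    using \<alpha> by (intro second_subderivative_scale_le[OF assms(1,2)]) auto
  then have "ereal (\<alpha>\<^sup>2) * second_subderivative j x g z
      \<le> ereal (\<alpha>\<^sup>2) * (ereal ((1 / \<alpha>)\<^sup>2) * second_subderivative j x g (\<alpha> *\<^sub>R z))"
    using \<alpha> by (intro ereal_mult_left_mono) auto
  then show "ereal (\<alpha>\<^sup>2) * second_subderivative j x g z \<le> second_subderivative j x g (\<alpha> *\<^sub>R z)"
    using \<alpha> by (simp flip: mult.assoc add: power_divide)
qed (rule second_subderivative_scale_le[OF assms])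

text \<open>Frechet differentiability is uniform over bounded directions, so \<open>H\<close> need
  not converge. This matters because the difference quotients of \<open>S\<close> are a priori only
  bounded.\<close>

lemma has_derivative_quotient_remainder:
  fixes f :: "'a::real_normed_vector \<Rightarrow> 'b::real_normed_vector"
  assumes f: "(f has_derivative f') (at a)"
    and T: "(T \<longlongrightarrow> 0) F" "\<forall>\<^sub>F i in F. T i > 0"
    and H: "\<forall>\<^sub>F i in F. norm (H i) \<le> M"
  shows "((\<lambda>i. (f (a + T i *\<^sub>R H i) - f a) /\<^sub>R T i - f' (H i)) \<longlongrightarrow> 0) F"
proof (rule tendstoI)
  fix e :: real
  assume e: "e > 0"
  define N where "N = \<bar>M\<bar> + 1"
  have N: "N > 0" by (simp add: N_def)
  interpret f': bounded_linear f' using f by (rule has_derivative_bounded_linear)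
  obtain d where d: "d > 0"
    and small: "\<And>y. norm (y - a) < d \<Longrightarrow> norm (f y - f a - f' (y - a)) \<le> e / (2 * N) * norm (y - a)"
    using f e N unfolding has_derivative_at_alt
    by (metis divide_pos_pos mult_pos_pos zero_less_numeral)
  have "\<forall>\<^sub>F i in F. T i < d / N"
    using order_tendstoD(2)[OF T(1), of "d / N"] d N by simp
  with T(2) H show "\<forall>\<^sub>F i in F. dist ((f (a + T i *\<^sub>R H i) - f a) /\<^sub>R T i - f' (H i)) 0 < e"
  proof eventually_elim
    case (elim i)
    have HN: "norm (H i) < N" using elim by (simp add: N_def)
    have "norm (T i *\<^sub>R H i) \<le> T i * N" using elim HN by simp
    also have "\<dots> < d" using elim N by (simp add: field_simps)
    finally have "norm (f (a + T i *\<^sub>R H i) - f a - f' (T i *\<^sub>R H i))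
        \<le> e / (2 * N) * norm (T i *\<^sub>R H i)"
      using small[of "a + T i *\<^sub>R H i"] by simp
    also have "\<dots> \<le> e / (2 * N) * (T i * N)"
      using e N elim HN by (intro mult_left_mono) auto
    also have "\<dots> = T i * (e / 2)" using N by simp
    finally have "norm (f (a + T i *\<^sub>R H i) - f a - f' (T i *\<^sub>R H i)) / T i \<le> e / 2"
      using elim by (simp add: field_simps)
    moreover have "(f (a + T i *\<^sub>R H i) - f a) /\<^sub>R T i - f' (H i)
        = (f (a + T i *\<^sub>R H i) - f a - f' (T i *\<^sub>R H i)) /\<^sub>R T i"
      using elim by (simp add: f'.scaleR scaleR_diff_right)
    moreover have "norm (v /\<^sub>R T i) = norm v / T i" for v :: 'b
      using elim by (simp add: divide_inverse mult.commute)
    ultimately have "norm ((f (a + T i *\<^sub>R H i) - f a) /\<^sub>R T i - f' (H i)) \<le> e / 2"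
      by metis
    then show ?case using e by simp
  qed
qed

section \<open>Perturbed variational inequalities\<close>

locale perturbed_vi =
  fixes j :: "('y::banach \<Rightarrow>\<^sub>L real) \<Rightarrow> ereal"
    and A :: "'p::real_normed_vector \<times> ('y \<Rightarrow>\<^sub>L real) \<Rightarrow> 'y"
    and S :: "'p \<Rightarrow> ('y \<Rightarrow>\<^sub>L real)"
    and p0 :: 'p and R c C :: real
    and Ap :: "'p \<Rightarrow>\<^sub>L 'y" and Ax :: "('y \<Rightarrow>\<^sub>L real) \<Rightarrow>\<^sub>L 'y"
    and x0 :: "'y \<Rightarrow>\<^sub>L real" and a0 :: 'y
    and Q :: "('y \<Rightarrow>\<^sub>L real) \<Rightarrow> ereal"
  assumes X: "hilbert_space TYPE('y \<Rightarrow>\<^sub>L real)"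
    and j: "proper j"
    and R: "R > 0"
    and S: "\<And>p. p \<in> cball p0 R \<Longrightarrow> solves_vi (\<lambda>x. A (p, x)) j (S p)"
    and c: "c > 0" and C: "C > 0"
    and A_mono: "\<And>x1 x2. c * (norm (x1 - x2))\<^sup>2 \<le> pairing (A (p0, x1) - A (p0, x2)) (x1 - x2)"
    and A_lipschitz: "\<And>x p. p \<in> cball p0 R \<Longrightarrow>
            norm (A (p, x) - A (p0, x)) \<le> C * norm (p - p0)"
    and x0_def: "x0 = S p0"
    and a0_def: "a0 = - A (p0, x0)"
    and A_deriv: "(A has_derivative (\<lambda>(q, h). Ap q + Ax h)) (at (p0, x0))"
    and Ap_surj: "surj (blinfun_apply Ap)"
    and Q_def: "Q = second_subderivative j x0 a0"
begin

abbreviation D where "D \<equiv> second_quotient j x0 a0"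

abbreviation linearized_vi where
  "linearized_vi q \<equiv> solves_vi (\<lambda>y. Ap q + Ax y) (\<lambda>z. ereal (1/2) * Q z)"

definition quot where "quot t q = (S (p0 + t *\<^sub>R q) - x0) /\<^sub>R t"

text \<open>Since \<open>a0\<close> is minus the unperturbed value of \<open>A\<close>, this is the
  difference quotient of \<open>A\<close> along the path of solutions.\<close>

definition slope where "slope t q = (A (p0 + t *\<^sub>R q, S (p0 + t *\<^sub>R q)) + a0) /\<^sub>R t"

section \<open>Elementary properties of the quotients and of the second subderivative\<close>

lemma j_not_MInfty: "j x \<noteq> - \<infinity>"
  using j by (simp add: proper_def)

lemma j_real_if_solves: "solves_vi F j x \<Longrightarrow> \<exists>r. j x = ereal r"
  using j_not_MInfty[of x] by (cases "j x") (auto simp: solves_vi_def)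

lemma solves_vi_realD:
  assumes "solves_vi F j x" "j x = ereal r" "j z = ereal s"
  shows "r \<le> s + pairing (F x) (z - x)"
proof -
  have "0 \<le> ereal (pairing (F x) (z - x)) + j z - j x"
    using assms(1) by (simp add: solves_vi_def)
  then show ?thesis using assms by simp
qed

lemma x0_solves: "solves_vi (\<lambda>x. A (p0, x)) j x0"
  using S[of p0] R by (simp add: x0_def)

lemma j_x0: "j x0 = ereal (real_of_ereal (j x0))"
  using j_real_if_solves[OF x0_solves] by auto

lemmas D_real = second_quotient_real[where j = j and x = x0 and g = a0, OF j_x0]
  and D_PInfty = second_quotient_PInfty[where j = j and x = x0 and g = a0, OF j_x0]

text \<open>By the choice of \<open>a0\<close>, the numerator is the unperturbed inequality tested
  at \<open>x0 + t z\<close>.\<close>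

lemma D_nonneg:
  assumes "t > 0"
  shows "0 \<le> D t z"
proof (cases "j (x0 + t *\<^sub>R z)")
  case (real s)
  have "0 \<le> s - real_of_ereal (j x0) - t * pairing a0 z"
    using solves_vi_realD[OF x0_solves j_x0 real]
    by (simp add: a0_def blinfun.minus_right blinfun.scaleR_left scaleR_blinfun.rep_eq)
  then show ?thesis
    using second_quotient_real[OF j_x0 real \<open>t > 0\<close>, of a0] \<open>t > 0\<close> by simp
next
  case PInf
  then show ?thesis using second_quotient_PInfty[OF j_x0 PInf \<open>t > 0\<close>, of a0] by simp
qed (simp add: j_not_MInfty)

lemma D_zero: "t > 0 \<Longrightarrow> D t 0 = 0"
  using D_real[of t 0 "real_of_ereal (j x0)"] j_x0
  by (simp add: zero_ereal_def zero_blinfun.rep_eq)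

lemma Q_le_liminf:
  "pos_null_seq t \<Longrightarrow> weak_star_conv zs z \<Longrightarrow> Q z \<le> liminf (\<lambda>n. D (t n) (zs n))"
  unfolding Q_def by (rule second_subderivative_le_liminf)

lemma Q_nonneg: "0 \<le> Q z"
  unfolding Q_def second_subderivative_def
  by (intro Inf_greatest) (auto intro!: Liminf_bounded always_eventually D_nonneg simp: pos_null_seq_def)

lemma Q_scale: "\<alpha> > 0 \<Longrightarrow> Q (\<alpha> *\<^sub>R z) = ereal (\<alpha>\<^sup>2) * Q z"
  unfolding Q_def by (rule second_subderivative_scale[OF j j_x0])

lemma Q_zero: "Q 0 = 0"
proof (rule antisym)
  have "Q 0 \<le> liminf (\<lambda>n. D (1 / real (Suc n)) 0)"
    by (intro Q_le_liminf pos_null_seq_inverse_Suc) (simp add: weak_star_conv_def)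
  also have "\<dots> = 0"
    by (simp add: D_zero Liminf_const)
  finally show "Q 0 \<le> 0" .
qed (rule Q_nonneg)

lemma half_Q_nonneg: "0 \<le> ereal (1/2) * Q z"
  using Q_nonneg[of z] by simp

lemma linearized_vi_iff:
  "linearized_vi q y \<longleftrightarrow> Q y < \<infinity> \<and> (\<forall>z. Q y \<le> Q z + ereal (2 * pairing (Ap q + Ax y) (z - y)))"
proof -
  have "ereal (1/2) * Q y \<le> ereal (1/2) * Q z + ereal r \<longleftrightarrow> Q y \<le> Q z + ereal (2 * r)" for z r
    using Q_nonneg[of y] Q_nonneg[of z] by (cases "Q y"; cases "Q z") auto
  moreover have "ereal (1/2) * Q y < \<infinity> \<longleftrightarrow> Q y < \<infinity>"
    using Q_nonneg[of y] by (cases "Q y") auto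
  ultimately show ?thesis
    using solves_vi_nonneg_iff[where F="\<lambda>z. ereal (1/2) * Q z" and G="\<lambda>y. Ap q + Ax y" and x=y]
      half_Q_nonneg by simp
qed

text \<open>The inequalities at \<open>p\<close> and at \<open>p0\<close> are tested with each
  other's solution, so \<open>j\<close> cancels; strong monotonicity at \<open>p0\<close> is then
  set against the perturbation bound.\<close>

lemma S_lipschitz:
  assumes p: "p \<in> cball p0 R"
  shows "norm (S p - x0) \<le> C / c * norm (p - p0)"
proof -
  define h where "h = S p - x0"
  obtain r where r: "j (S p) = ereal r" using j_real_if_solves[OF S[OF p]] by blast
  have "c * (norm h)\<^sup>2 \<le> pairing (A (p0, S p) - A (p0, x0)) h"
    using A_mono by (simp add: h_def)
  also have "\<dots> \<le> pairing (A (p0, S p) - A (p, S p)) h"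
    using solves_vi_realD[OF S[OF p] r j_x0] solves_vi_realD[OF x0_solves j_x0 r]
    by (simp add: h_def blinfun.bilinear_simps)
  also have "\<dots> \<le> norm h * norm (A (p0, S p) - A (p, S p))"
    using norm_blinfun[of h "A (p0, S p) - A (p, S p)"] by (simp add: abs_le_iff)
  also have "\<dots> \<le> norm h * (C * norm (p - p0))"
    using A_lipschitz[OF p, of "S p"] by (intro mult_left_mono) (auto simp: norm_minus_commute)
  finally have "norm h * (c * norm h) \<le> norm h * (C * norm (p - p0))"
    by (simp add: power2_eq_square mult_ac)
  then have "c * norm h \<le> C * norm (p - p0)"
    using C by (cases "h = 0") (auto simp: mult_le_cancel_left)
  then show ?thesis using c by (simp add: h_def field_simps)
qed

section \<open>Difference quotients of the solution map\<close>

lemma S_eq_quot: "t > 0 \<Longrightarrow> S (p0 + t *\<^sub>R q) = x0 + t *\<^sub>R quot t q"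
  by (simp add: quot_def)

lemma quot_bounded:
  assumes "t > 0" "p0 + t *\<^sub>R q \<in> cball p0 R"
  shows "norm (quot t q) \<le> C / c * norm q"
proof -
  have "norm (quot t q) = norm (S (p0 + t *\<^sub>R q) - x0) / t"
    using assms(1) by (simp add: quot_def divide_inverse mult.commute)
  then show ?thesis
    using S_lipschitz[OF assms(2)] assms(1) by (simp add: pos_divide_le_eq mult_ac)
qed

text \<open>The inequality at \<open>p0 + t q\<close> is tested with \<open>x0 + t z\<close> and
  divided by \<open>t^2 / 2\<close>. Splitting off \<open>a0\<close> turns the values of
  \<open>j\<close> into second-order quotients and leaves \<open>slope\<close> as
  coefficient.\<close>

lemma D_quot_le:
  assumes t: "t > 0" and p: "p0 + t *\<^sub>R q \<in> cball p0 R"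
  shows "D t (quot t q) \<le> D t z + ereal (2 * pairing (slope t q) (z - quot t q))"
proof -
  let ?p = "p0 + t *\<^sub>R q" and ?y = "quot t q"
  obtain r where r: "j (S ?p) = ereal r" using j_real_if_solves[OF S[OF p]] by blast
  have r': "j (x0 + t *\<^sub>R ?y) = ereal r" using r S_eq_quot[OF t] by simp
  show ?thesis
  proof (cases "j (x0 + t *\<^sub>R z)")
    case (real s)
    have "t *\<^sub>R slope t q = A (?p, S ?p) + a0" using t by (simp add: slope_def)
    then have "pairing (A (?p, S ?p)) (t *\<^sub>R (z - ?y))
        = pairing (t *\<^sub>R slope t q - a0) (t *\<^sub>R (z - ?y))"
      by simp
    also have "\<dots> = t\<^sup>2 * pairing (slope t q) (z - ?y) - t * pairing a0 z + t * pairing a0 ?y"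
      by (simp add: blinfun.bilinear_simps algebra_simps power2_eq_square)
    finally have "r \<le> s + t\<^sup>2 * pairing (slope t q) (z - ?y) - t * pairing a0 z + t * pairing a0 ?y"
      using solves_vi_realD[OF S[OF p] r real] S_eq_quot[OF t, of q]
      by (simp add: scaleR_diff_right)
    then have "(r - real_of_ereal (j x0) - t * pairing a0 ?y) / (t\<^sup>2 / 2)
        \<le> (s - real_of_ereal (j x0) - t * pairing a0 z
           + t\<^sup>2 * pairing (slope t q) (z - ?y)) / (t\<^sup>2 / 2)"
      using t by (intro divide_right_mono) auto
    also have "\<dots> = (s - real_of_ereal (j x0) - t * pairing a0 z) / (t\<^sup>2 / 2)
        + 2 * pairing (slope t q) (z - ?y)"
      using t by (simp add: field_simps)
    finally show ?thesis
      using D_real[OF real t] D_real[OF r' t]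
      by simp
  next
    case PInf
    then show ?thesis using D_PInfty[OF PInf t] by simp
  qed (simp add: j_not_MInfty)
qed

lemma eventually_in_ball:
  assumes "(t \<longlongrightarrow> 0) F" "\<forall>\<^sub>F i in F. t i > 0" "\<forall>\<^sub>F i in F. norm (q i) \<le> M"
  shows "\<forall>\<^sub>F i in F. p0 + t i *\<^sub>R q i \<in> cball p0 R"
proof -
  have "\<forall>\<^sub>F i in F. t i < R / (\<bar>M\<bar> + 1)"
    using order_tendstoD(2)[OF assms(1)] R by simp
  with assms(2,3) show ?thesis
  proof eventually_elim
    case (elim i)
    have "t i * norm (q i) \<le> R / (\<bar>M\<bar> + 1) * (\<bar>M\<bar> + 1)"
      using elim R by (intro mult_mono) auto
    then show ?case using elim by (simp add: dist_norm)
  qed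
qed

text \<open>\<open>A\<close> is linearised along the directions
  \<open>(q i, quot (t i) (q i))\<close>, which are bounded by \<open>quot_bounded\<close>; the
  quotients may still fail to converge.\<close>

lemma slope_remainder:
  assumes t: "(t \<longlongrightarrow> 0) F" "\<forall>\<^sub>F i in F. t i > 0" and q: "\<forall>\<^sub>F i in F. norm (q i) \<le> M"
  shows "((\<lambda>i. slope (t i) (q i) - (Ap (q i) + Ax (quot (t i) (q i)))) \<longlongrightarrow> 0) F"
proof -
  define H where "H i = (q i, quot (t i) (q i))" for i
  have "\<forall>\<^sub>F i in F. norm (H i) \<le> M + C / c * M"
    using t(2) q eventually_in_ball[OF t q]
  proof eventually_elim
    case (elim i)
    have "norm (H i) \<le> norm (q i) + norm (quot (t i) (q i))"
      unfolding H_def norm_Pair by (rule sqrt_sum_squares_le_sum) auto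
    also have "norm (quot (t i) (q i)) \<le> C / c * norm (q i)" using elim by (intro quot_bounded)
    also have "\<dots> \<le> C / c * M" using elim c C by (intro mult_left_mono) auto
    finally show ?case using elim by simp
  qed
  from has_derivative_quotient_remainder[OF A_deriv t this] show ?thesis
  proof (rule tendsto_cong[THEN iffD1, rotated])
    show "\<forall>\<^sub>F i in F. (A ((p0, x0) + t i *\<^sub>R H i) - A (p0, x0)) /\<^sub>R t i
          - (case H i of (q, h) \<Rightarrow> Ap q + Ax h)
        = slope (t i) (q i) - (Ap (q i) + Ax (quot (t i) (q i)))"
      using t(2)
      by eventually_elim (unfold H_def slope_def, simp add: a0_def S_eq_quot)
  qed
qed

lemma slope_tendsto:
  assumes t: "(t \<longlongrightarrow> 0) F" "\<forall>\<^sub>F i in F. t i > 0"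
    and q: "(q \<longlongrightarrow> l) F" and y: "((\<lambda>i. quot (t i) (q i)) \<longlongrightarrow> y) F"
  shows "((\<lambda>i. slope (t i) (q i)) \<longlongrightarrow> Ap l + Ax y) F"
proof -
  have "\<forall>\<^sub>F i in F. norm (q i) < norm l + 1"
    using tendsto_norm[OF q] by (rule order_tendstoD) simp
  then have "\<forall>\<^sub>F i in F. norm (q i) \<le> norm l + 1" by (rule eventually_mono) simp
  from slope_remainder[OF t this]
  have "((\<lambda>i. slope (t i) (q i) - (Ap (q i) + Ax (quot (t i) (q i)))
      + (Ap (q i) + Ax (quot (t i) (q i)))) \<longlongrightarrow> 0 + (Ap l + Ax y)) F"
    by (intro tendsto_add blinfun.tendsto tendsto_const q y)
  then show ?thesis by simp
qed

text \<open>Strong monotonicity between \<open>x0 + t h\<close> and \<open>x0\<close> is divided by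
  \<open>t^2\<close> and passed to the limit.\<close>

lemma Ax_coercive: "c * (norm h)\<^sup>2 \<le> pairing (Ax h) h"
proof -
  let ?f = "\<lambda>t. (A ((p0, x0) + t *\<^sub>R (0, h)) - A (p0, x0)) /\<^sub>R t"
  have pos: "\<forall>\<^sub>F t in at_right (0::real). t > 0" by (simp add: eventually_at_right_less)
  have "((\<lambda>t. ?f t - (case (0, h) of (q, h) \<Rightarrow> Ap q + Ax h)) \<longlongrightarrow> 0) (at_right 0)"
    by (rule has_derivative_quotient_remainder[OF A_deriv _ pos, where M = "norm (0::'p, h)"])
      (auto intro: tendsto_eq_intros)
  then have "(?f \<longlongrightarrow> Ax h) (at_right 0)"
    by (simp add: Lim_null[of _ "Ax h"] blinfun.zero_right)
  then have "((\<lambda>t. pairing (?f t) h) \<longlongrightarrow> pairing (Ax h) h) (at_right 0)"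
    by (intro tendsto_intros)
  moreover have "\<forall>\<^sub>F t in at_right 0. c * (norm h)\<^sup>2 \<le> pairing (?f t) h"
    using pos
  proof eventually_elim
    case (elim t)
    have "c * (norm (t *\<^sub>R h))\<^sup>2 \<le> pairing (A (p0, x0 + t *\<^sub>R h) - A (p0, x0)) (t *\<^sub>R h)"
      using A_mono[of "x0 + t *\<^sub>R h" x0] by simp
    also have "\<dots> = t\<^sup>2 * pairing (?f t) h"
      using elim by (simp add: blinfun.bilinear_simps power2_eq_square field_simps)
    finally have "t\<^sup>2 * (c * (norm h)\<^sup>2) \<le> t\<^sup>2 * pairing (?f t) h"
      by (simp add: power_mult_distrib mult_ac)
    then show ?case using elim by (simp add: mult_le_cancel_left)
  qed
  ultimately show ?thesis
    by (intro tendsto_lowerbound) auto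
qed

lemma linearized_vi_unique:
  assumes "linearized_vi q y1" "linearized_vi q y2"
  shows "y1 = y2"
proof -
  have "solves_vi (\<lambda>y. 1 *\<^sub>R Ax y - (- Ap q)) (\<lambda>z. ereal (1/2) * Q z) y" if "linearized_vi q y" for y
    using that by (simp add: add.commute)
  from vi_solution_lipschitz[OF half_Q_nonneg Ax_coercive _ this this, of y1 y2] assms
  show ?thesis using c by (simp add: mult_le_0_iff)
qed

text \<open>
  Comparing the inequality at \<open>t\<close> with the test point \<open>\<alpha> y\<^bsub>\<alpha> t\<^esub>\<close> makes the scaled quotients
  \<open>D t y\<^sub>t\<close> satisfy the hypothesis of \<open>tendsto_if_scaling_inequality\<close>. Without this, the limit is
  only available along those sequences that realise the infimum in \<open>Q\<close>.
\<close>

lemma quot_tendsto_imp: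
  assumes lim: "((\<lambda>t. quot t q) \<longlongrightarrow> d) (at_right 0)"
  shows D_quot_tendsto: "((\<lambda>t. D t (quot t q)) \<longlongrightarrow> Q d) (at_right 0)"
    and linearized_vi_limit: "linearized_vi q d"
proof -
  define W where "W = Ap q + Ax d"
  define f where "f t = real_of_ereal (D t (quot t q))" for t
  have pos: "\<forall>\<^sub>F t in at_right (0::real). t > 0" by (simp add: eventually_at_right_less)
  have id0: "((\<lambda>t. t) \<longlongrightarrow> (0::real)) (at_right 0)" by (rule tendsto_ident_at)
  have slope: "((\<lambda>t. slope t q) \<longlongrightarrow> W) (at_right 0)"
    unfolding W_def by (rule slope_tendsto[OF id0 pos tendsto_const lim])
  have in_ball: "\<forall>\<^sub>F t in at_right 0. p0 + t *\<^sub>R q \<in> cball p0 R"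
    by (rule eventually_in_ball[OF id0 pos, of "\<lambda>_. q" "norm q"]) simp
  \<comment> \<open>The bound from the test point \<open>z = 0\<close>, where the quotient vanishes;
    it makes \<open>D\<close> finite, so that the real function \<open>f\<close> represents it near
    zero.\<close>
  define B where "B t = 2 * pairing (slope t q) (- quot t q)" for t
  have D_bounds: "\<forall>\<^sub>F t in at_right 0. 0 \<le> D t (quot t q) \<and> D t (quot t q) \<le> ereal (B t)"
    using pos in_ball
  proof eventually_elim
    case (elim t)
    then show ?case
      using D_quot_le[of t q 0] D_nonneg[of t "quot t q"] D_zero[of t]
      by (simp add: B_def)
  qed
  then have D_eq: "\<forall>\<^sub>F t in at_right 0. D t (quot t q) = ereal (f t)"
  proof eventually_elim
    case (elim t)
    then show ?case unfolding f_def by (cases "D t (quot t q)") auto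
  qed
  have "(B \<longlongrightarrow> 2 * pairing W (- d)) (at_right 0)"
    unfolding B_def by (intro tendsto_intros slope lim)
  then have "\<forall>\<^sub>F t in at_right 0. B t < 2 * pairing W (- d) + 1"
    by (rule order_tendstoD) simp
  with D_bounds have bdd: "\<forall>\<^sub>F t in at_right 0. \<bar>f t\<bar> \<le> 2 * pairing W (- d) + 1"
    using D_eq
  proof eventually_elim
    case (elim t)
    then show ?case by simp
  qed
  have f_lim: "(f \<longlongrightarrow> - pairing W d) (at_right 0)"
  proof (rule tendsto_if_scaling_inequality[OF bdd])
    fix \<alpha> e :: real
    assume \<alpha>: "0 < \<alpha>" and e: "e > 0"
    have scale: "filterlim (\<lambda>t. \<alpha> * t) (at_right 0) (at_right 0)"
      unfolding filterlim_at using \<alpha>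
      by (auto intro!: tendsto_eq_intros eventually_at_right_less simp: eventually_at_filter)
    have "((\<lambda>t. 2 * pairing (slope t q) (\<alpha> *\<^sub>R quot (\<alpha> * t) q - quot t q))
        \<longlongrightarrow> 2 * pairing W (\<alpha> *\<^sub>R d - d)) (at_right 0)"
      by (intro tendsto_intros slope lim filterlim_compose[OF lim scale])
    moreover have "2 * pairing W (\<alpha> *\<^sub>R d - d) = 2 * (\<alpha> - 1) * pairing W d"
      by (simp add: blinfun.bilinear_simps algebra_simps)
    ultimately have "\<forall>\<^sub>F t in at_right 0. 2 * pairing (slope t q) (\<alpha> *\<^sub>R quot (\<alpha> * t) q - quot t q)
        < 2 * (\<alpha> - 1) * pairing W d + e"
      using e by (intro order_tendstoD(2)) auto
    with pos in_ball D_eq eventually_at_right_scale[OF D_eq \<alpha>]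
    show "\<forall>\<^sub>F t in at_right 0. f t \<le> \<alpha>\<^sup>2 * f (\<alpha> * t) + 2 * (\<alpha> - 1) * pairing W d + e"
    proof eventually_elim
      case (elim t)
      have "D t (\<alpha> *\<^sub>R quot (\<alpha> * t) q) = ereal (\<alpha>\<^sup>2 * f (\<alpha> * t))"
        using second_quotient_scale[OF j j_x0 elim(1) \<alpha>, of a0] elim(4) by simp
      with D_quot_le[OF elim(1,2), of "\<alpha> *\<^sub>R quot (\<alpha> * t) q"] elim(3,5) show ?case by simp
    qed
  qed
  \<comment> \<open>\<open>D_quot_le\<close> along an arbitrary admissible pair for
    \<open>z\<close>. Weak-star convergence of \<open>zs\<close> suffices because
    \<open>slope\<close> converges in norm.\<close>
  have lower: "ereal (- pairing W d - 2 * pairing W (z - d)) \<le> Q z" for z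
    unfolding Q_def second_subderivative_def
  proof (intro Inf_greatest, clarify)
    fix t zs
    assume t: "pos_null_seq t" and zs: "weak_star_conv zs z"
    note seq = pos_null_seq_filterlim[OF t]
    let ?b = "\<lambda>n. f (t n) - 2 * pairing (slope (t n) q) (zs n - quot (t n) q)"
    have slope_n: "(\<lambda>n. slope (t n) q) \<longlonglongrightarrow> W"
      and quot_n: "(\<lambda>n. quot (t n) q) \<longlonglongrightarrow> d"
      and f_n: "(\<lambda>n. f (t n)) \<longlonglongrightarrow> - pairing W d"
      using filterlim_compose[OF slope seq] filterlim_compose[OF lim seq]
        filterlim_compose[OF f_lim seq] by simp_all
    have "(\<lambda>n. pairing (slope (t n) q) (zs n) - pairing (slope (t n) q) (quot (t n) q))
        \<longlonglongrightarrow> pairing W z - pairing W d"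
      by (intro tendsto_diff tendsto_weak_star_pairing[OF zs slope_n] blinfun.tendsto slope_n quot_n)
    then have "?b \<longlonglongrightarrow> - pairing W d - 2 * pairing W (z - d)"
      by (intro tendsto_diff tendsto_mult tendsto_const f_n) (simp add: blinfun.diff_left)
    then have "ereal (- pairing W d - 2 * pairing W (z - d)) = liminf (\<lambda>n. ereal (?b n))"
      by (intro lim_imp_Liminf[symmetric]) auto
    also have "\<dots> \<le> liminf (\<lambda>n. D (t n) (zs n))"
    proof (rule Liminf_mono)
      have "\<forall>\<^sub>F s in at_right 0. s > 0 \<and> p0 + s *\<^sub>R q \<in> cball p0 R \<and> D s (quot s q) = ereal (f s)"
        using pos in_ball D_eq by eventually_elim simp
      from eventually_compose_filterlim[OF this seq]
      show "\<forall>\<^sub>F n in sequentially. ereal (?b n) \<le> D (t n) (zs n)"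
      proof eventually_elim
        case (elim n)
        then show ?case
          using D_quot_le[of "t n" q "zs n"] by (cases "D (t n) (zs n)") auto
      qed
    qed
    finally show "ereal (- pairing W d - 2 * pairing W (z - d))
        \<le> liminf (\<lambda>n. D (t n) (zs n))" .
  qed
  have lim_D: "((\<lambda>t. D t (quot t q)) \<longlongrightarrow> ereal (- pairing W d)) (at_right 0)"
    using f_lim tendsto_cong[OF D_eq] by simp
  \<comment> \<open>The difference quotients are themselves admissible for \<open>Q d\<close>;
    together with \<open>lower\<close> at \<open>z = d\<close> this determines
    \<open>Q d\<close>.\<close>
  have "Q d \<le> liminf (\<lambda>n. D (1 / real (Suc n)) (quot (1 / real (Suc n)) q))"
    using filterlim_compose[OF lim pos_null_seq_filterlim[OF pos_null_seq_inverse_Suc]]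
    by (intro Q_le_liminf pos_null_seq_inverse_Suc weak_star_conv_if_tendsto)
  also have "\<dots> = ereal (- pairing W d)"
    using filterlim_compose[OF lim_D pos_null_seq_filterlim[OF pos_null_seq_inverse_Suc]]
    by (intro lim_imp_Liminf) auto
  finally have Qd: "Q d = ereal (- pairing W d)"
    using lower[of d] by (intro antisym) (auto simp: zero_blinfun.rep_eq)
  then show "((\<lambda>t. D t (quot t q)) \<longlongrightarrow> Q d) (at_right 0)"
    using lim_D by simp
  have "Q d \<le> Q z + ereal (2 * pairing W (z - d))" for z
    using lower[of z] Qd by (cases "Q z") auto
  then show "linearized_vi q d"
    using Qd by (simp add: linearized_vi_iff W_def)
qed

section \<open>Recovery sequences and consequences of differentiability\<close>

text \<open>The pointwise form of strong twice epi-differentiability: it is first established on the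
  range of the derivative and then carried over to limits.\<close>

definition recoverable where
  "recoverable z \<longleftrightarrow> (\<forall>t. pos_null_seq t \<longrightarrow>
     (\<exists>zs. zs \<longlonglongrightarrow> z \<and> (\<lambda>n. D (t n) (zs n)) \<longlonglongrightarrow> Q z))"

lemma strongly_twice_epi_differentiable_iff:
  "strongly_twice_epi_differentiable j x0 a0 \<longleftrightarrow> (\<forall>z. recoverable z)"
  unfolding recoverable_def unfolding strongly_twice_epi_differentiable_def Q_def ..

lemma quot_limit_recoverable:
  assumes "((\<lambda>t. quot t q) \<longlongrightarrow> d) (at_right 0)"
  shows "recoverable d"
  unfolding recoverable_def
proof (intro allI impI exI conjI)
  fix t
  assume "pos_null_seq t"
  then have seq: "filterlim t (at_right 0) sequentially" by (rule pos_null_seq_filterlim)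
  show "(\<lambda>n. quot (t n) q) \<longlonglongrightarrow> d"
    by (rule filterlim_compose[OF assms seq])
  show "(\<lambda>n. D (t n) (quot (t n) q)) \<longlonglongrightarrow> Q d"
    by (rule filterlim_compose[OF D_quot_tendsto[OF assms] seq])
qed

text \<open>One tolerance \<open>e\<close> governs both the distance to \<open>z\<close> and the
  excess over \<open>a\<close>, so \<open>diagonal_selection\<close> merges the recovery sequences
  of all \<open>u k\<close> into one.\<close>

lemma diagonal_recovery:
  assumes u: "u \<longlonglongrightarrow> z" and rec: "\<And>k. recoverable (u k)" and le: "\<And>k. Q (u k) \<le> ereal a"
    and t: "pos_null_seq t"
  obtains zs where "zs \<longlonglongrightarrow> z"
    "\<And>e. e > 0 \<Longrightarrow> \<forall>\<^sub>F n in sequentially. D (t n) (zs n) < ereal (a + e)"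
proof -
  let ?P = "\<lambda>n w e. dist w z < e \<and> D (t n) w < ereal (a + e)"
  obtain zs where zs: "\<And>e. e > 0 \<Longrightarrow> \<forall>\<^sub>F n in sequentially. ?P n (zs n) e"
  proof (rule diagonal_selection[of ?P])
    fix e :: real
    assume e: "e > 0"
    then obtain k where k: "dist (u k) z < e / 2"
      using metric_LIMSEQ_D[OF u, of "e / 2"] by auto
    obtain ws where ws: "ws \<longlonglongrightarrow> u k" "(\<lambda>n. D (t n) (ws n)) \<longlonglongrightarrow> Q (u k)"
      using rec[of k] t unfolding recoverable_def by blast
    have "Q (u k) < ereal (a + e)" using e by (intro le_less_trans[OF le[of k]]) simp
    then have "\<forall>\<^sub>F n in sequentially. D (t n) (ws n) < ereal (a + e)"
      using ws(2) by (rule order_tendstoD(2)[rotated])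
    moreover have "\<forall>\<^sub>F n in sequentially. dist (ws n) (u k) < e / 2"
      by (rule tendstoD[OF ws(1)]) (use e in simp)
    ultimately show "\<forall>\<^sub>F n in sequentially. \<exists>w. ?P n w e"
    proof eventually_elim
      case (elim n)
      moreover have "dist (ws n) z < e"
        using elim(2) k dist_triangle[of "ws n" z "u k"] by linarith
      ultimately show ?case by blast
    qed
  next
    fix n w e e'
    assume "?P n w e" "e \<le> (e' :: real)"
    moreover from this have "ereal (a + e) \<le> ereal (a + e')" by simp
    ultimately show "?P n w e'" by (meson less_le_trans)
  qed blast
  have "zs \<longlonglongrightarrow> z"
    by (rule tendstoI, rule eventually_mono, rule zs) auto
  moreover have "\<forall>\<^sub>F n in sequentially. D (t n) (zs n) < ereal (a + e)" if "e > 0" for e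
    using zs[OF that] by (rule eventually_mono) simp
  ultimately show thesis using that by blast
qed

lemma Q_le_of_eventually_le:
  assumes "pos_null_seq t" "weak_star_conv zs z"
    and "\<And>e. e > 0 \<Longrightarrow> \<forall>\<^sub>F n in sequentially. D (t n) (zs n) \<le> ereal (a + e)"
  shows "Q z \<le> ereal a"
proof (rule ereal_le_epsilon2)
  fix e :: real
  assume "e > 0"
  have "Q z \<le> liminf (\<lambda>n. D (t n) (zs n))" by (rule Q_le_liminf) fact+
  also have "\<dots> \<le> liminf (\<lambda>n. ereal (a + e))"
    by (rule Liminf_mono) (rule assms(3)[OF \<open>e > 0\<close>])
  finally show "Q z \<le> ereal a + ereal e" by (simp add: Liminf_const)
qed

text \<open>The diagonal sequence is admissible in the infimum that defines \<open>Q z\<close>, so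
  its quotients bound \<open>Q z\<close>.\<close>

lemma Q_lsc_recoverable:
  assumes u: "u \<longlonglongrightarrow> z" and rec: "\<And>k. recoverable (u k)" and le: "\<And>k. Q (u k) \<le> ereal a"
  shows "Q z \<le> ereal a"
proof -
  obtain zs where zs: "zs \<longlonglongrightarrow> z"
    and D: "\<And>e. e > 0 \<Longrightarrow> \<forall>\<^sub>F n in sequentially. D (1 / real (Suc n)) (zs n) < ereal (a + e)"
    using diagonal_recovery[OF u rec le pos_null_seq_inverse_Suc] by blast
  have "\<forall>\<^sub>F n in sequentially. D (1 / real (Suc n)) (zs n) \<le> ereal (a + e)" if "e > 0" for e
    using D[OF that] by (rule eventually_mono) (rule less_imp_le)
  then show ?thesis
    by (rule Q_le_of_eventually_le[OF pos_null_seq_inverse_Suc weak_star_conv_if_tendsto[OF zs]])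
qed

text \<open>The lower estimate holds for every admissible sequence by the definition of
  \<open>Q\<close>; only the upper one depends on the choice of \<open>zs\<close>.\<close>

lemma recoverable_if_limsup_le:
  assumes "\<And>t. pos_null_seq t \<Longrightarrow> \<exists>zs. zs \<longlonglongrightarrow> z \<and>
    (\<forall>e>Q z. \<forall>\<^sub>F n in sequentially. D (t n) (zs n) < e)"
  shows "recoverable z"
  unfolding recoverable_def
proof (intro allI impI)
  fix t
  assume t: "pos_null_seq t"
  then obtain zs where zs: "zs \<longlonglongrightarrow> z"
    and upper: "\<And>e. e > Q z \<Longrightarrow> \<forall>\<^sub>F n in sequentially. D (t n) (zs n) < e"
    using assms by blast
  have "(\<lambda>n. D (t n) (zs n)) \<longlonglongrightarrow> Q z"
  proof (rule order_tendstoI)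
    fix e
    assume "e < Q z"
    then show "\<forall>\<^sub>F n in sequentially. e < D (t n) (zs n)"
      using Q_le_liminf[OF t weak_star_conv_if_tendsto[OF zs]] by (simp add: le_Liminf_iff)
  qed (rule upper)
  with zs show "\<exists>zs. zs \<longlonglongrightarrow> z \<and> (\<lambda>n. D (t n) (zs n)) \<longlonglongrightarrow> Q z" by blast
qed

lemma recoverable_limit:
  assumes u: "u \<longlonglongrightarrow> z" and rec: "\<And>k. recoverable (u k)" and le: "\<And>k. Q (u k) \<le> Q z"
  shows "recoverable z"
proof (rule recoverable_if_limsup_le)
  fix t
  assume t: "pos_null_seq t"
  show "\<exists>zs. zs \<longlonglongrightarrow> z \<and> (\<forall>e>Q z. \<forall>\<^sub>F n in sequentially. D (t n) (zs n) < e)"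
  proof (cases "Q z")
    case (real a)
    obtain zs where zs: "zs \<longlonglongrightarrow> z"
      and D: "\<And>e. e > 0 \<Longrightarrow> \<forall>\<^sub>F n in sequentially. D (t n) (zs n) < ereal (a + e)"
      using diagonal_recovery[OF u rec _ t, of a] le real by metis
    have "\<forall>\<^sub>F n in sequentially. D (t n) (zs n) < e" if "Q z < e" for e
    proof -
      obtain b where b: "Q z < ereal b" "ereal b < e" using ereal_dense2[OF \<open>Q z < e\<close>] by auto
      then have "\<forall>\<^sub>F n in sequentially. D (t n) (zs n) < ereal (a + (b - a))"
        using real by (intro D) simp
      then show ?thesis using b(2) by (auto elim!: eventually_mono)
    qed
    with zs show ?thesis by blast
  next
    case PInf
    then show ?thesis by (intro exI[of _ "\<lambda>_. z"]) auto
  next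
    case MInf
    then show ?thesis using Q_nonneg[of z] by simp
  qed
qed

section \<open>Consequences of convergent difference quotients\<close>

context
  fixes dS :: "'p \<Rightarrow> ('y \<Rightarrow>\<^sub>L real)"
  assumes dS: "\<And>q. ((\<lambda>t. quot t q) \<longlongrightarrow> dS q) (at_right 0)"
begin

lemma linearized_vi_iff_dS: "linearized_vi q y \<longleftrightarrow> y = dS q"
  using linearized_vi_limit[OF dS] linearized_vi_unique by blast

text \<open>
  A resolvent of \<open>Q / 2\<close> solves the linearised inequality for a right-hand side depending on the
  resolvent itself; surjectivity of \<open>Ap\<close> realises it as \<open>- Ap q\<close>.
\<close>

lemma resolvents_in_range:
  obtains lam y where "\<And>n :: nat. (lam n :: real) > 0" "filterlim lam at_top sequentially"
    "\<And>n. y n \<in> range dS"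
    "\<And>n w. Q (y n) \<le> Q w + ereal (2 * lam n * pairing (Ax (y n - z)) (w - y n))"
    "\<And>n. Q (y n) < \<infinity>"
proof -
  have solvable: "\<exists>y. solves_vi (\<lambda>y. Ax y - g) (\<lambda>z. ereal (1/2) * Q z) y" for g
  proof -
    obtain q where "Ap q = - g" using Ap_surj by (metis surjD)
    then show ?thesis using linearized_vi_limit[OF dS, of q] by auto
  qed
  obtain lam y where lam: "\<And>n :: nat. (lam n :: real) > 0" "filterlim lam at_top sequentially"
    and y: "\<And>n. solves_vi (\<lambda>y. lam n *\<^sub>R Ax (y - z)) (\<lambda>z. ereal (1/2) * Q z) (y n)"
    using vi_resolvents[OF half_Q_nonneg c Ax_coercive solvable, of z] by blast
  have y_dS: "\<exists>q. linearized_vi q (y n) \<and> Ap q + Ax (y n) = lam n *\<^sub>R Ax (y n - z)" for n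
  proof -
    obtain q where q: "Ap q = lam n *\<^sub>R Ax (y n - z) - Ax (y n)" using Ap_surj by (metis surjD)
    then have eq: "Ap q + Ax (y n) = lam n *\<^sub>R Ax (y n - z)" by simp
    then have "linearized_vi q (y n)" using y[of n] by (simp add: solves_vi_def)
    with eq show ?thesis by blast
  qed
  have "y n \<in> range dS" for n
    using y_dS[of n] by (auto simp: linearized_vi_iff_dS)
  moreover have "Q (y n) \<le> Q w + ereal (2 * lam n * pairing (Ax (y n - z)) (w - y n))" for n w
    using y_dS[of n] by (auto simp: linearized_vi_iff blinfun.scaleR_right mult.assoc)
  moreover have "Q (y n) < \<infinity>" for n
    using y_dS[of n] by (auto simp: linearized_vi_iff)
  ultimately show thesis using lam that by blast
qed

lemma dS_recoverable: "recoverable (dS q)"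
  by (rule quot_limit_recoverable[OF dS])

lemma range_recoverable: "u \<in> range dS \<Longrightarrow> recoverable u"
  using dS_recoverable by auto

text \<open>Coercivity and \<open>Q \<ge> 0\<close> turn the hypothesis into
  \<open>2 lam n c (norm (y n - z))^2 \<le> a\<close>, and \<open>lam\<close> tends to
  infinity.\<close>

lemma resolvents_tendsto:
  fixes lam :: "nat \<Rightarrow> real"
  assumes lam: "\<And>n. lam n > 0" "filterlim lam at_top sequentially"
    and le: "\<And>n. Q (y n) + ereal (2 * lam n * pairing (Ax (y n - z)) (y n - z)) \<le> ereal a"
  shows "y \<longlonglongrightarrow> z" and "Q (y n) \<le> ereal a"
proof -
  have bound: "Q (y n) \<le> ereal a \<and> 2 * lam n * c * (norm (y n - z))\<^sup>2 \<le> a" for n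
  proof -
    define m where "m = 2 * lam n * pairing (Ax (y n - z)) (y n - z)"
    define k where "k = 2 * lam n * c * (norm (y n - z))\<^sup>2"
    have "2 * lam n * (c * (norm (y n - z))\<^sup>2) \<le> m"
      unfolding m_def using lam(1)[of n] Ax_coercive by (intro mult_left_mono) auto
    then have "k \<le> m" by (simp add: k_def mult.assoc)
    moreover have "0 \<le> k"
      using lam(1)[of n] c by (simp add: k_def)
    moreover have "Q (y n) + ereal m \<le> ereal a"
      using le[of n] by (simp add: m_def)
    ultimately have "Q (y n) \<le> ereal a \<and> k \<le> a"
      using Q_nonneg[of "y n"] by (cases "Q (y n)") auto
    then show ?thesis by (simp add: k_def)
  qed
  then show "Q (y n) \<le> ereal a" by blast
  have "(\<lambda>n. (norm (y n - z))\<^sup>2) \<longlonglongrightarrow> 0"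
  proof (rule Lim_null_comparison)
    show "\<forall>\<^sub>F n in sequentially. norm ((norm (y n - z))\<^sup>2) \<le> a / (2 * c) * inverse (lam n)"
      using bound lam(1) c by (intro always_eventually allI) (simp add: field_simps)
    show "(\<lambda>n. a / (2 * c) * inverse (lam n)) \<longlonglongrightarrow> 0"
      by (intro tendsto_mult_right_zero tendsto_inverse_0_at_top lam(2))
  qed
  then have "(\<lambda>n. norm (y n - z)) \<longlonglongrightarrow> 0"
    using tendsto_real_sqrt[of "\<lambda>n. (norm (y n - z))\<^sup>2" 0] by simp
  then show "y \<longlonglongrightarrow> z"
    by (simp add: LIM_zero_iff tendsto_norm_zero_iff)
qed

text \<open>
  Each resolvent \<open>y\<^sub>n\<close> provides a weakly continuous affine minorant of \<open>Q\<close>, and \<open>Q z\<close> is the supremum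
  of their values at \<open>z\<close>.
\<close>

lemma Q_weakly_lsc: "weakly_lsc Q"
  unfolding weakly_lsc_def
proof
  fix a
  show "openin weak_topology {x. a < Q x}"
  proof (subst openin_subopen, intro ballI)
    fix z
    assume z: "z \<in> {x. a < Q x}"
    have weak_open: "openin weak_topology (blinfun_apply f -` V)" if "open V"
      for f :: "('y \<Rightarrow>\<^sub>L real) \<Rightarrow>\<^sub>L real" and V
      unfolding weak_topology_def by (intro topology_generated_by_Basis CollectI exI[of _ f] exI[of _ V] conjI refl that)
    show "\<exists>T. openin weak_topology T \<and> z \<in> T \<and> T \<subseteq> {x. a < Q x}"
    proof (cases "a < 0")
      case True
      then have "a < Q x" for x using Q_nonneg by (rule less_le_trans)
      then have "{x. a < Q x} = UNIV" by auto
      then show ?thesis using weak_open[of UNIV 0] by auto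
    next
      case False
      then obtain a' where a': "a = ereal a'"
        using z by (cases a) auto
      obtain lam y where lam: "\<And>n :: nat. (lam n :: real) > 0" "filterlim lam at_top sequentially"
        and y: "\<And>n. y n \<in> range dS"
        and min: "\<And>n w. Q (y n) \<le> Q w + ereal (2 * lam n * pairing (Ax (y n - z)) (w - y n))"
        and fin: "\<And>n. Q (y n) < \<infinity>"
        using resolvents_in_range by blast
      \<comment> \<open>Otherwise every minorant is at most \<open>a'\<close> at \<open>z\<close>.
        The resolvents then converge to \<open>z\<close> with values of \<open>Q\<close> at most
        \<open>a'\<close>, and lower semicontinuity along the range contradicts
        \<open>a < Q z\<close>.\<close>
      have "\<exists>n. a < Q (y n) + ereal (2 * lam n * pairing (Ax (y n - z)) (y n - z))"
      proof (rule ccontr)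
        assume "\<not> ?thesis"
        then have "\<And>n. Q (y n) + ereal (2 * lam n * pairing (Ax (y n - z)) (y n - z)) \<le> ereal a'"
          by (simp add: a' not_less)
        note le = resolvents_tendsto[OF lam this]
        have "Q z \<le> ereal a'"
          by (rule Q_lsc_recoverable[OF le(1) range_recoverable[OF y] le(2)])
        then show False using z a' by simp
      qed
      then obtain n where n: "a < Q (y n) + ereal (2 * lam n * pairing (Ax (y n - z)) (y n - z))"
        by blast
      obtain b where b: "Q (y n) = ereal b"
        using fin[of n] Q_nonneg[of "y n"] by (cases "Q (y n)") auto
      define v where "v = (2 * lam n) *\<^sub>R Ax (y n - z)"
      define f where "f = Blinfun (\<lambda>x :: 'y \<Rightarrow>\<^sub>L real. pairing v x)"
      have f: "f x = pairing v x" for x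
        unfolding f_def
        by (subst bounded_linear_Blinfun_apply) (auto intro: blinfun.bounded_linear_left)
      \<comment> \<open>\<open>f w\<close> lies in this half-line exactly when the affine minorant
        exceeds \<open>a'\<close> at \<open>w\<close>.\<close>
      let ?V = "{..<b + pairing v (y n) - a'}"
      have "z \<in> blinfun_apply f -` ?V"
        using n by (simp add: f b a' v_def blinfun.bilinear_simps algebra_simps)
      moreover have "a < Q w" if "w \<in> blinfun_apply f -` ?V" for w
      proof -
        have "a' < b - pairing v (w - y n)"
          using that by (simp add: f blinfun.diff_left)
        moreover have "ereal b \<le> Q w + ereal (pairing v (w - y n))"
          using min[of n w] by (simp add: b v_def blinfun.scaleR_right)
        ultimately show ?thesis using Q_nonneg[of w] by (cases "Q w") (auto simp: a')
      qed
      ultimately show ?thesis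
        using weak_open[of ?V f] by (intro exI[of _ "blinfun_apply f -` ?V"]) auto
    qed
  qed
qed

text \<open>The resolvents of \<open>z\<close> serve: their inequality tested at
  \<open>w = z\<close> gives \<open>Q (y n) \<le> Q z\<close>, and lower semicontinuity along the
  range gives the opposite bound in the limit.\<close>

lemma approximation_from_range:
  assumes "Q z < \<infinity>"
  obtains y where "\<And>n :: nat. y n \<in> range dS" "y \<longlonglongrightarrow> z" "\<And>n. Q (y n) \<le> Q z"
    "(\<lambda>n. Q (y n)) \<longlonglongrightarrow> Q z"
proof -
  obtain a where a: "Q z = ereal a"
    using assms Q_nonneg[of z] by (cases "Q z") auto
  obtain lam y where lam: "\<And>n :: nat. (lam n :: real) > 0" "filterlim lam at_top sequentially"
    and y: "\<And>n. y n \<in> range dS"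
    and min: "\<And>n w. Q (y n) \<le> Q w + ereal (2 * lam n * pairing (Ax (y n - z)) (w - y n))"
    and fin: "\<And>n. Q (y n) < \<infinity>"
    using resolvents_in_range by blast
  have "Q (y n) + ereal (2 * lam n * pairing (Ax (y n - z)) (y n - z)) \<le> ereal a" for n
  proof -
    have "pairing (Ax (y n - z)) (z - y n) = - pairing (Ax (y n - z)) (y n - z)"
      by (simp add: blinfun.diff_left)
    then show ?thesis
      using min[of n z] fin[of n] Q_nonneg[of "y n"] a by (cases "Q (y n)") auto
  qed
  note le = resolvents_tendsto[OF lam this]
  have "(\<lambda>n. Q (y n)) \<longlonglongrightarrow> Q z"
  proof (rule order_tendstoI)
    fix e
    assume e: "e < Q z"
    show "\<forall>\<^sub>F n in sequentially. e < Q (y n)"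
    proof (rule ccontr)
      assume "\<not> ?thesis"
      then have "\<exists>\<^sub>F n in sequentially. Q (y n) \<le> e" by (simp add: frequently_def not_le)
      then have inf: "infinite {n. Q (y n) \<le> e}"
        by (simp add: frequently_cofinite cofinite_eq_sequentially[symmetric])
      \<comment> \<open>The indices violating the lower bound form a subsequence that still
        converges to \<open>z\<close>, so \<open>Q z\<close> would be at most
        \<open>e\<close>.\<close>
      let ?s = "enumerate {n. Q (y n) \<le> e}"
      have Q_e: "Q (y (?s n)) \<le> e" for n using enumerate_in_set[OF inf] by simp
      then have "0 \<le> e" using Q_nonneg order_trans by blast
      then obtain e' where e': "e = ereal e'" using e by (cases e) auto
      have y_s: "(\<lambda>n. y (?s n)) \<longlonglongrightarrow> z"
        using LIMSEQ_subseq_LIMSEQ[OF le(1) strict_mono_enumerate[OF inf]] by (simp add: o_def)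
      have "Q z \<le> ereal e'"
        by (rule Q_lsc_recoverable[OF y_s range_recoverable[OF y]]) (use Q_e e' in simp)
      then show False using e e' by simp
    qed
  next
    fix e
    assume "Q z < e"
    then have "Q (y n) < e" for n
      by (intro le_less_trans[OF le(2)]) (simp add: a)
    then show "\<forall>\<^sub>F n in sequentially. Q (y n) < e" by simp
  qed
  with le a show thesis by (intro that[OF y]) auto
qed

text \<open>Where \<open>Q z\<close> is infinite the upper estimate is vacuous, so the constant
  sequence recovers \<open>z\<close>.\<close>

lemma all_recoverable: "recoverable z"
proof (cases "Q z < \<infinity>")
  case True
  then obtain y where y: "\<And>n :: nat. y n \<in> range dS" "y \<longlonglongrightarrow> z" "\<And>n. Q (y n) \<le> Q z"
    "(\<lambda>n. Q (y n)) \<longlonglongrightarrow> Q z"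
    using approximation_from_range[OF True] by blast
  show ?thesis by (rule recoverable_limit[OF y(2) range_recoverable[OF y(1)] y(3)])
next
  case False
  then have "Q z = \<infinity>" by simp
  then show ?thesis
    by (intro recoverable_if_limsup_le exI[of _ "\<lambda>_. z"]) auto
qed

lemma increasing_approximation_from_range:
  assumes "Q z < \<infinity>"
  shows "\<exists>y :: nat \<Rightarrow> ('y \<Rightarrow>\<^sub>L real). range y \<subseteq> range dS \<and> y \<longlonglongrightarrow> z \<and>
    incseq (\<lambda>k. Q (y k)) \<and> (\<lambda>k. Q (y k)) \<longlonglongrightarrow> Q z"
proof -
  obtain y where y: "\<And>n :: nat. y n \<in> range dS" "y \<longlonglongrightarrow> z" "\<And>n. Q (y n) \<le> Q z"
    "(\<lambda>n. Q (y n)) \<longlonglongrightarrow> Q z"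
    using approximation_from_range[OF assms] by blast
  obtain r where r: "strict_mono (r :: nat \<Rightarrow> nat)" "incseq (\<lambda>n. Q (y (r n)))"
    using incseq_subseq_if_le_limit[OF y(4,3)] by blast
  show ?thesis
  proof (intro exI[of _ "\<lambda>n. y (r n)"] conjI)
    show "(\<lambda>n. y (r n)) \<longlonglongrightarrow> z" "(\<lambda>k. Q (y (r k))) \<longlonglongrightarrow> Q z"
      using LIMSEQ_subseq_LIMSEQ[OF y(2) r(1)] LIMSEQ_subseq_LIMSEQ[OF y(4) r(1)]
      by (simp_all add: o_def)
  qed (use y r in auto)
qed

end

section \<open>Equivalence of differentiability and epi-differentiability\<close>

lemma has_strong_hadamard_derivative_iff:
  "has_strong_hadamard_derivative S p0 q d \<longleftrightarrow>
    (\<forall>qt. (qt \<longlongrightarrow> q) (at_right 0) \<longrightarrow> ((\<lambda>t. quot t (qt t)) \<longlongrightarrow> d) (at_right 0))"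
  unfolding has_strong_hadamard_derivative_def quot_def unfolding x0_def ..

lemma quot_tendsto_if_hadamard:
  "has_strong_hadamard_derivative S p0 q d \<Longrightarrow> ((\<lambda>t. quot t q) \<longlongrightarrow> d) (at_right 0)"
  by (simp add: has_strong_hadamard_derivative_iff)

lemma strong_hadamard_derivative_eq:
  assumes "has_strong_hadamard_derivative S p0 q d"
  shows "strong_hadamard_derivative S p0 q = d"
  unfolding strong_hadamard_derivative_def
proof (rule the_equality, rule assms)
  show "d' = d" if "has_strong_hadamard_derivative S p0 q d'" for d'
    using tendsto_unique[OF _ quot_tendsto_if_hadamard[OF that] quot_tendsto_if_hadamard[OF assms]]
    by simp
qed

lemma quot_seq_bounded:
  assumes t: "pos_null_seq t" and qs: "qs \<longlonglongrightarrow> q"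
  obtains M where "\<And>n. norm (quot (t n) (qs n)) \<le> M"
proof -
  have t0: "t \<longlonglongrightarrow> 0" "\<forall>\<^sub>F n in sequentially. t n > 0" and pos: "\<And>n. t n > 0"
    using t by (auto simp: pos_null_seq_def)
  obtain N where N: "\<And>n. norm (qs n) \<le> N"
    using convergent_imp_Bseq[OF convergentI[OF qs]] by (auto simp: Bseq_def)
  have "\<forall>\<^sub>F n in sequentially. p0 + t n *\<^sub>R qs n \<in> cball p0 R"
    using N by (intro eventually_in_ball[OF t0, of _ N]) simp
  then have "\<forall>\<^sub>F n in sequentially. norm (quot (t n) (qs n)) \<le> C / c * N"
  proof (rule eventually_mono)
    fix n
    assume "p0 + t n *\<^sub>R qs n \<in> cball p0 R"
    then have "norm (quot (t n) (qs n)) \<le> C / c * norm (qs n)" using pos by (intro quot_bounded)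
    also have "\<dots> \<le> C / c * N" using N c C by (intro mult_left_mono) auto
    finally show "norm (quot (t n) (qs n)) \<le> C / c * N" .
  qed
  then have "Bseq (\<lambda>n. quot (t n) (qs n))" by (rule BfunI)
  then show thesis using that by (auto simp: Bseq_def)
qed

text \<open>
  The weak limit \<open>y\<close> of the difference quotients is tested with strong recovery sequences; with
  \<open>z = y\<close> the coercivity of \<open>Ax\<close> upgrades weak to strong convergence.
\<close>

lemma quot_subseq_limit:
  assumes rec: "\<And>z. recoverable z" and t: "pos_null_seq t" and qs: "qs \<longlonglongrightarrow> q"
  obtains r y where "strict_mono (r :: nat \<Rightarrow> nat)" "(\<lambda>n. quot (t (r n)) (qs (r n))) \<longlonglongrightarrow> y"
    "linearized_vi q y"
proof -
  obtain ip :: "('y \<Rightarrow>\<^sub>L real) \<Rightarrow> ('y \<Rightarrow>\<^sub>L real) \<Rightarrow> real" where ip: "inner_product_norm ip"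
    using X unfolding hilbert_space_def inner_product_norm_def by blast
  obtain M where M: "\<And>n. norm (quot (t n) (qs n)) \<le> M"
    using quot_seq_bounded[OF t qs] by blast
  obtain r y where r: "strict_mono (r :: nat \<Rightarrow> nat)"
    and weak: "\<And>f :: ('y \<Rightarrow>\<^sub>L real) \<Rightarrow>\<^sub>L real. (\<lambda>n. f (quot (t (r n)) (qs (r n)))) \<longlonglongrightarrow> f y"
    by (rule inner_product_norm.bounded_seq_weakly_convergent_subseq[OF ip M]) (rule that)
  define tn where "tn n = t (r n)" for n
  define qn where "qn n = qs (r n)" for n
  define yn where "yn n = quot (tn n) (qn n)" for n
  define rem where "rem n = slope (tn n) (qn n) - (Ap (qn n) + Ax (yn n))" for n
  have tn: "pos_null_seq tn" unfolding tn_def by (rule pos_null_seq_subseq[OF t r])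
  then have tn0: "tn \<longlonglongrightarrow> 0" "\<forall>\<^sub>F n in sequentially. tn n > 0"
    by (auto simp: pos_null_seq_def)
  have qn: "qn \<longlonglongrightarrow> q"
    using LIMSEQ_subseq_LIMSEQ[OF qs r] by (simp add: qn_def[abs_def] o_def)
  obtain N where N: "\<And>n. norm (qn n) \<le> N"
    using convergent_imp_Bseq[OF convergentI[OF qn]] by (auto simp: Bseq_def)
  have rem: "rem \<longlonglongrightarrow> 0"
    unfolding rem_def[abs_def] yn_def using N by (intro slope_remainder[OF tn0, of _ N]) simp
  have in_ball: "\<forall>\<^sub>F n in sequentially. p0 + tn n *\<^sub>R qn n \<in> cball p0 R"
    using N by (intro eventually_in_ball[OF tn0, of _ N]) simp
  have yn_M: "norm (yn n) \<le> M" for n using M by (simp add: yn_def tn_def qn_def)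
  have weak_yn: "(\<lambda>n. f (yn n)) \<longlonglongrightarrow> f y" for f :: "('y \<Rightarrow>\<^sub>L real) \<Rightarrow>\<^sub>L real"
    using weak by (simp add: yn_def tn_def qn_def)
  have weak_star: "weak_star_conv yn y"
    unfolding weak_star_conv_def
  proof
    fix v :: 'y
    have "blinfun_apply (Blinfun (\<lambda>x :: 'y \<Rightarrow>\<^sub>L real. pairing v x)) x = pairing v x" for x
      by (subst bounded_linear_Blinfun_apply) (auto intro: blinfun.bounded_linear_left)
    then show "(\<lambda>n. pairing v (yn n)) \<longlonglongrightarrow> pairing v y"
      using weak_yn[of "Blinfun (\<lambda>x. pairing v x)"] by simp
  qed
  \<comment> \<open>Composition with \<open>Ax\<close> turns \<open>v\<close> into a bounded
    functional, against which \<open>yn\<close> converges weakly.\<close>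
  have weak_Ax: "(\<lambda>n. pairing (Ax (yn n)) v) \<longlonglongrightarrow> pairing (Ax y) v" for v :: "'y \<Rightarrow>\<^sub>L real"
    using weak_yn[of "v o\<^sub>L Ax"] by simp
  have upper: "\<forall>\<^sub>F n in sequentially. D (tn n) (yn n) + ereal (2 * c * (norm (yn n - y))\<^sup>2)
      \<le> ereal (b + 2 * pairing (Ap q + Ax y) (z - y) + e)"
    if zs: "zs \<longlonglongrightarrow> z" and D_zs: "(\<lambda>n. D (tn n) (zs n)) \<longlonglongrightarrow> ereal b" and e: "e > 0"
    for zs z b e
  proof -
    \<comment> \<open>\<open>slope\<close> is split into \<open>rem\<close>, \<open>Ap\<close> and
      \<open>Ax\<close> parts. \<open>E\<close> collects the terms with a limit; the remaining term
      \<open>- 2 pairing (Ax (yn n - y)) (yn n - y)\<close> is not controlled by weak convergence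
      and is moved to the left by coercivity.\<close>
    define E where "E n = 2 * (pairing (rem n + Ap (qn n)) (zs n - yn n)
      + pairing (Ax (yn n)) (zs n - y) - pairing (Ax y) (yn n - y))" for n
    have "(\<lambda>n. pairing (Ax (yn n)) (zs n - z)) \<longlonglongrightarrow> 0"
    proof (rule Lim_null_comparison)
      have "norm (pairing (Ax (yn n)) (zs n - z)) \<le> norm (zs n - z) * (norm Ax * M)" for n
      proof -
        have "norm (Ax (yn n)) \<le> norm Ax * norm (yn n)" by (rule norm_blinfun)
        also have "\<dots> \<le> norm Ax * M" using yn_M by (intro mult_left_mono) auto
        finally show ?thesis
          using norm_blinfun[of "zs n - z" "Ax (yn n)"] by (meson mult_left_mono norm_ge_zero order_trans)
      qed
      then show "\<forall>\<^sub>F n in sequentially. norm (pairing (Ax (yn n)) (zs n - z))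
          \<le> norm (zs n - z) * (norm Ax * M)" by simp
      show "(\<lambda>n. norm (zs n - z) * (norm Ax * M)) \<longlonglongrightarrow> 0"
        using zs by (intro tendsto_mult_left_zero tendsto_norm_zero) (simp add: LIM_zero)
    qed
    then have "(\<lambda>n. pairing (Ax (yn n)) (zs n - z) + pairing (Ax (yn n)) (z - y))
        \<longlonglongrightarrow> 0 + pairing (Ax y) (z - y)"
      by (intro tendsto_add weak_Ax)
    then have 1: "(\<lambda>n. pairing (Ax (yn n)) (zs n - y)) \<longlonglongrightarrow> pairing (Ax y) (z - y)"
      by (simp add: blinfun.diff_left)
    have rq: "(\<lambda>n. rem n + Ap (qn n)) \<longlonglongrightarrow> 0 + Ap q"
      by (intro tendsto_add rem blinfun.tendsto tendsto_const qn)
    have "(\<lambda>n. pairing (rem n + Ap (qn n)) (zs n) - pairing (rem n + Ap (qn n)) (yn n))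
        \<longlonglongrightarrow> pairing (0 + Ap q) z - pairing (0 + Ap q) y"
      by (intro tendsto_diff blinfun.tendsto zs rq tendsto_weak_star_pairing[OF weak_star])
    then have 2: "(\<lambda>n. pairing (rem n + Ap (qn n)) (zs n - yn n)) \<longlonglongrightarrow> pairing (Ap q) (z - y)"
      by (simp add: blinfun.diff_left)
    have "(\<lambda>n. pairing (Ax y) (yn n) - pairing (Ax y) y) \<longlonglongrightarrow> pairing (Ax y) y - pairing (Ax y) y"
      by (intro tendsto_diff tendsto_const tendsto_weak_star_pairing[OF weak_star])
    then have 3: "(\<lambda>n. pairing (Ax y) (yn n - y)) \<longlonglongrightarrow> 0"
      by (simp add: blinfun.diff_left)
    have "E \<longlonglongrightarrow> 2 * (pairing (Ap q) (z - y) + pairing (Ax y) (z - y) - 0)"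
      unfolding E_def[abs_def] by (intro tendsto_mult tendsto_add tendsto_diff tendsto_const 1 2 3)
    then have "E \<longlonglongrightarrow> 2 * pairing (Ap q + Ax y) (z - y)"
      by (simp add: blinfun.add_right)
    then have "(\<lambda>n. D (tn n) (zs n) + ereal (E n))
        \<longlonglongrightarrow> ereal b + ereal (2 * pairing (Ap q + Ax y) (z - y))"
      by (intro tendsto_add_ereal D_zs) auto
    moreover have "ereal b + ereal (2 * pairing (Ap q + Ax y) (z - y))
        < ereal (b + 2 * pairing (Ap q + Ax y) (z - y) + e)" using e by simp
    ultimately have "\<forall>\<^sub>F n in sequentially. D (tn n) (zs n) + ereal (E n)
        < ereal (b + 2 * pairing (Ap q + Ax y) (z - y) + e)"
      by (rule order_tendstoD(2))
    with tn0(2) in_ball show ?thesis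
    proof eventually_elim
      case (elim n)
      have "2 * pairing (slope (tn n) (qn n)) (zs n - yn n)
          = E n - 2 * pairing (Ax (yn n - y)) (yn n - y)"
        unfolding E_def rem_def by (simp add: blinfun.bilinear_simps algebra_simps)
      also have "\<dots> \<le> E n - 2 * c * (norm (yn n - y))\<^sup>2"
        using Ax_coercive[of "yn n - y"] by simp
      finally have "2 * pairing (slope (tn n) (qn n)) (zs n - yn n)
          \<le> E n - 2 * c * (norm (yn n - y))\<^sup>2" .
      moreover have "D (tn n) (yn n)
          \<le> D (tn n) (zs n) + ereal (2 * pairing (slope (tn n) (qn n)) (zs n - yn n))"
        unfolding yn_def by (rule D_quot_le) (use elim in auto)
      moreover have "0 \<le> D (tn n) (yn n)" "0 \<le> D (tn n) (zs n)"
        using elim(1) by (auto intro: D_nonneg)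
      ultimately have "D (tn n) (yn n) + ereal (2 * c * (norm (yn n - y))\<^sup>2)
          \<le> D (tn n) (zs n) + ereal (E n)"
        by (cases "D (tn n) (yn n)"; cases "D (tn n) (zs n)") auto
      then show ?case using elim(3) by simp
    qed
  qed
  have Q_le: "Q y \<le> ereal (b + 2 * pairing (Ap q + Ax y) (z - y))"
    if "zs \<longlonglongrightarrow> z" "(\<lambda>n. D (tn n) (zs n)) \<longlonglongrightarrow> ereal b" for zs z b
  proof (rule Q_le_of_eventually_le[OF tn weak_star])
    fix e :: real
    assume "e > 0"
    from upper[OF that this]
    show "\<forall>\<^sub>F n in sequentially. D (tn n) (yn n)
        \<le> ereal (b + 2 * pairing (Ap q + Ax y) (z - y) + e)"
    proof eventually_elim
      case (elim n)
      have "0 \<le> 2 * c * (norm (yn n - y))\<^sup>2" using c by simp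
      then have "D (tn n) (yn n) + 0 \<le> D (tn n) (yn n) + ereal (2 * c * (norm (yn n - y))\<^sup>2)"
        by (intro add_left_mono) simp
      then show ?case using elim by simp
    qed
  qed
  \<comment> \<open>The zero sequence as competitor shows that \<open>Q y\<close> is finite.\<close>
  have "(\<lambda>n. D (tn n) 0) \<longlonglongrightarrow> ereal 0"
    using tn by (simp add: D_zero pos_null_seq_def zero_ereal_def)
  from Q_le[OF tendsto_const this] obtain a where a: "Q y = ereal a"
    using Q_nonneg[of y] by (cases "Q y") auto
  have "linearized_vi q y"
    unfolding linearized_vi_iff
  proof (intro conjI allI)
    show "Q y < \<infinity>" using a by simp
    fix z
    show "Q y \<le> Q z + ereal (2 * pairing (Ap q + Ax y) (z - y))"
    proof (cases "Q z")
      case (real b)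
      obtain zs where "zs \<longlonglongrightarrow> z" "(\<lambda>n. D (tn n) (zs n)) \<longlonglongrightarrow> ereal b"
        using rec[of z] tn real unfolding recoverable_def by auto
      from Q_le[OF this] show ?thesis using real by simp
    qed (use Q_nonneg[of z] in auto)
  qed
  moreover have "yn \<longlonglongrightarrow> y"
  proof (rule metric_LIMSEQ_I)
    fix e :: real
    assume e: "e > 0"
    \<comment> \<open>With recovery sequences of \<open>y\<close> the pairing term vanishes, and
      \<open>D (tn n) (yn n)\<close> exceeds \<open>a - d\<close>. Hence
      \<open>2 c (norm (yn n - y))^2 < 2 d\<close>, which is the claim for
      \<open>d = c e^2\<close>.\<close>
    define d where "d = c * e\<^sup>2"
    have d: "d > 0" using c e by (simp add: d_def)
    obtain zs where "zs \<longlonglongrightarrow> y" "(\<lambda>n. D (tn n) (zs n)) \<longlonglongrightarrow> ereal a"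
      using rec[of y] tn a unfolding recoverable_def by auto
    from upper[OF this d]
    have "\<forall>\<^sub>F n in sequentially. D (tn n) (yn n) + ereal (2 * c * (norm (yn n - y))\<^sup>2)
        \<le> ereal (a + d)"
      by (simp add: blinfun.zero_left)
    moreover have "ereal (a - d) < Q y" using a d by simp
    then have "\<forall>\<^sub>F n in sequentially. ereal (a - d) < D (tn n) (yn n)"
      using Q_le_liminf[OF tn weak_star] by (simp add: le_Liminf_iff)
    ultimately have "\<forall>\<^sub>F n in sequentially. dist (yn n) y < e"
    proof eventually_elim
      case (elim n)
      then have "2 * c * (norm (yn n - y))\<^sup>2 < 2 * d"
        by (cases "D (tn n) (yn n)") auto
      then have "(norm (yn n - y))\<^sup>2 < e\<^sup>2" using c by (simp add: d_def)
      then show ?case using e by (simp add: dist_norm power_less_imp_less_base)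
    qed
    then show "\<exists>no. \<forall>n\<ge>no. dist (yn n) y < e" by (simp add: eventually_sequentially)
  qed
  ultimately show thesis
    using that[OF r] by (simp add: yn_def[abs_def] tn_def qn_def)
qed

text \<open>Every sequence of quotients has a subsequence converging to a solution of the linearised
  inequality. That solution is unique, so one sample sequence already identifies the
  derivative.\<close>

lemma hadamard_if_recoverable:
  assumes rec: "\<And>z. recoverable z"
  shows "\<exists>d. has_strong_hadamard_derivative S p0 q d"
proof -
  obtain r d where d: "linearized_vi q d"
    using quot_subseq_limit[OF rec pos_null_seq_inverse_Suc tendsto_const] by blast
  have "((\<lambda>t. quot t (qt t)) \<longlongrightarrow> d) (at_right 0)" if qt: "(qt \<longlongrightarrow> q) (at_right 0)" for qt
    unfolding tendsto_at_iff_sequentially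
  proof (intro allI impI)
    fix t :: "nat \<Rightarrow> real"
    assume "\<forall>i. t i \<in> {0<..} - {0}" "t \<longlonglongrightarrow> 0"
    then have t: "pos_null_seq t" by (simp add: pos_null_seq_def)
    have qs: "(\<lambda>n. qt (t n)) \<longlonglongrightarrow> q"
      by (rule filterlim_compose[OF qt pos_null_seq_filterlim[OF t]])
    have "(\<lambda>n. quot (t n) (qt (t n))) \<longlonglongrightarrow> d"
    proof (rule tendsto_if_subseqs)
      fix s :: "nat \<Rightarrow> nat"
      assume s: "strict_mono s"
      have "(\<lambda>n. qt (t (s n))) \<longlonglongrightarrow> q"
        using LIMSEQ_subseq_LIMSEQ[OF qs s] by (simp add: o_def)
      then obtain r y where "strict_mono (r :: nat \<Rightarrow> nat)"
        "(\<lambda>n. quot (t (s (r n))) (qt (t (s (r n))))) \<longlonglongrightarrow> y" "linearized_vi q y"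
        using quot_subseq_limit[OF rec pos_null_seq_subseq[OF t s]] by blast
      then show "\<exists>r. strict_mono (r :: nat \<Rightarrow> nat) \<and> (\<lambda>n. quot (t (s (r n))) (qt (t (s (r n))))) \<longlonglongrightarrow> d"
        using linearized_vi_unique[OF _ d] by blast
    qed
    then show "((\<lambda>t. quot t (qt t)) \<circ> t) \<longlonglongrightarrow> d" by (simp add: o_def)
  qed
  then show ?thesis by (auto simp: has_strong_hadamard_derivative_iff)
qed

lemma hadamard_iff_epi_differentiable:
  "(\<forall>q. \<exists>d. has_strong_hadamard_derivative S p0 q d) \<longleftrightarrow>
    strongly_twice_epi_differentiable j x0 a0"
proof
  assume "\<forall>q. \<exists>d. has_strong_hadamard_derivative S p0 q d"
  then obtain dS where "\<And>q. has_strong_hadamard_derivative S p0 q (dS q)" by metis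
  then show "strongly_twice_epi_differentiable j x0 a0"
    using all_recoverable quot_tendsto_if_hadamard strongly_twice_epi_differentiable_iff by blast
next
  assume "strongly_twice_epi_differentiable j x0 a0"
  then show "\<forall>q. \<exists>d. has_strong_hadamard_derivative S p0 q d"
    using hadamard_if_recoverable by (simp add: strongly_twice_epi_differentiable_iff)
qed

end

theorem theorem4p1:
  fixes j :: "('y::banach \<Rightarrow>\<^sub>L real) \<Rightarrow> ereal"
    and A :: "'p::real_normed_vector \<times> ('y \<Rightarrow>\<^sub>L real) \<Rightarrow> 'y"
    and S :: "'p \<Rightarrow> ('y \<Rightarrow>\<^sub>L real)"
    and p0 :: 'p and R c C :: real
    and Ap :: "'p \<Rightarrow>\<^sub>L 'y" and Ax :: "('y \<Rightarrow>\<^sub>L real) \<Rightarrow>\<^sub>L 'y"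
    and x0 :: "'y \<Rightarrow>\<^sub>L real" and a0 :: 'y
    and Q :: "('y \<Rightarrow>\<^sub>L real) \<Rightarrow> ereal" and K :: "('y \<Rightarrow>\<^sub>L real) set"
    and dS :: "'p \<Rightarrow> ('y \<Rightarrow>\<^sub>L real)"
  assumes Y: "reflexive_space TYPE('y) \<or> separable_space (euclidean :: 'y topology)"
    and X: "hilbert_space TYPE('y \<Rightarrow>\<^sub>L real)"
    and j: "proper j"
    and R: "R > 0"
    and S: "\<And>p. p \<in> cball p0 R \<Longrightarrow> solves_vi (\<lambda>x. A (p, x)) j (S p)"
    and S_unique: "\<And>p x. p \<in> cball p0 R \<Longrightarrow> solves_vi (\<lambda>x. A (p, x)) j x \<Longrightarrow> x = S p"
    and c: "c > 0" and C: "C > 0"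
    and A_mono: "\<And>x1 x2. c * (norm (x1 - x2))\<^sup>2 \<le> pairing (A (p0, x1) - A (p0, x2)) (x1 - x2)"
    and A_lipschitz: "\<And>x p. p \<in> cball p0 R \<Longrightarrow>
            norm (A (p, x) - A (p0, x)) \<le> C * norm (p - p0)"
    and x0_def: "x0 = S p0"
    and a0_def: "a0 = - A (p0, x0)"
    and A_deriv: "(A has_derivative (\<lambda>(q, h). Ap q + Ax h)) (at (p0, x0))"
    and Ap_surj: "surj (blinfun_apply Ap)"
    and Q_def: "Q = second_subderivative j x0 a0"
    and K_def: "K = reduced_critical_cone j x0 a0"
    and dS_def: "dS = strong_hadamard_derivative S p0"
  shows "((\<forall>q. \<exists>d. has_strong_hadamard_derivative S p0 q d) \<longleftrightarrow>
            strongly_twice_epi_differentiable j x0 a0) \<and>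
         ((\<forall>q. \<exists>d. has_strong_hadamard_derivative S p0 q d) \<or>
            strongly_twice_epi_differentiable j x0 a0 \<longrightarrow>
          \<comment> \<open>(i)\<close>
          ((\<forall>z. 0 \<le> Q z) \<and> proper Q \<and> weakly_lsc Q \<and>
           (\<forall>\<alpha>>0. \<forall>z. Q (\<alpha> *\<^sub>R z) = ereal (\<alpha>\<^sup>2) * Q z) \<and>
           cone K \<and> 0 \<in> K) \<and>
          \<comment> \<open>(ii)\<close>
          (\<forall>q. (\<forall>y. solves_vi (\<lambda>y. Ap q + Ax y) (\<lambda>z. ereal (1/2) * Q z) y \<longleftrightarrow> y = dS q) \<and>
               ((\<lambda>t. second_quotient j x0 a0 t ((S (p0 + t *\<^sub>R q) - x0) /\<^sub>R t))
                  \<longlongrightarrow> Q (dS q)) (at_right 0)) \<and>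
          \<comment> \<open>(iii)\<close>
          (\<forall>z\<in>K. \<exists>y :: nat \<Rightarrow> ('y \<Rightarrow>\<^sub>L real).
              range y \<subseteq> range dS \<and> y \<longlonglongrightarrow> z \<and>
              incseq (\<lambda>k. Q (y k)) \<and> (\<lambda>k. Q (y k)) \<longlonglongrightarrow> Q z) \<and>
          range dS \<subseteq> K \<and> K \<subseteq> closure (range dS))"
proof -
  interpret perturbed_vi j A S p0 R c C Ap Ax x0 a0 Q
    by unfold_locales fact+
  show ?thesis
  proof (intro conjI impI allI ballI hadamard_iff_epi_differentiable)
    assume "(\<forall>q. \<exists>d. has_strong_hadamard_derivative S p0 q d) \<or>
      strongly_twice_epi_differentiable j x0 a0"
    then have "\<exists>d. has_strong_hadamard_derivative S p0 q d" for q
      using hadamard_iff_epi_differentiable by blast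
    then have quot_dS: "((\<lambda>t. quot t q) \<longlongrightarrow> dS q) (at_right 0)" for q
      using quot_tendsto_if_hadamard strong_hadamard_derivative_eq unfolding dS_def by metis
    have mem_K: "z \<in> K \<longleftrightarrow> Q z < \<infinity>" for z
      by (simp add: K_def reduced_critical_cone_def Q_def)
    show "0 \<le> Q z" for z by (rule Q_nonneg)
    show "proper Q"
    proof -
      have "Q x \<noteq> - \<infinity>" for x using Q_nonneg[of x] by auto
      moreover have "Q 0 \<noteq> \<infinity>" by (simp add: Q_zero)
      ultimately show ?thesis by (auto simp: proper_def)
    qed
    show "weakly_lsc Q" by (rule Q_weakly_lsc[OF quot_dS])
    show "Q (\<alpha> *\<^sub>R z) = ereal (\<alpha>\<^sup>2) * Q z" if "\<alpha> > 0" for \<alpha> z by (rule Q_scale[OF that])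
    show "0 \<in> K" by (simp add: mem_K Q_zero)
    show "cone K"
      \<comment> \<open>\<open>cone\<close> includes the factor 0, which positive homogeneity leaves
        out; there \<open>Q 0 = 0\<close> is used.\<close>
      unfolding cone_def
    proof (intro ballI allI impI)
      fix z and s :: real
      assume z: "z \<in> K" and s: "s \<ge> 0"
      then show "s *\<^sub>R z \<in> K"
        using Q_scale[of s z] Q_nonneg[of z] by (cases "s = 0"; cases "Q z") (auto simp: mem_K Q_zero)
    qed
    show "solves_vi (\<lambda>y. Ap q + Ax y) (\<lambda>z. ereal (1/2) * Q z) y \<longleftrightarrow> y = dS q" for q y
      by (rule linearized_vi_iff_dS[OF quot_dS])
    show "((\<lambda>t. second_quotient j x0 a0 t ((S (p0 + t *\<^sub>R q) - x0) /\<^sub>R t)) \<longlongrightarrow> Q (dS q)) (at_right 0)"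
      for q using D_quot_tendsto[OF quot_dS] by (simp add: quot_def)
    show incr: "\<exists>y :: nat \<Rightarrow> ('y \<Rightarrow>\<^sub>L real). range y \<subseteq> range dS \<and> y \<longlonglongrightarrow> z \<and>
        incseq (\<lambda>k. Q (y k)) \<and> (\<lambda>k. Q (y k)) \<longlonglongrightarrow> Q z" if "z \<in> K" for z
      using that by (intro increasing_approximation_from_range[OF quot_dS]) (simp add: mem_K)
    show "range dS \<subseteq> K"
    proof -
      have "linearized_vi q (dS q)" for q by (rule linearized_vi_limit[OF quot_dS])
      then show ?thesis by (auto simp: mem_K linearized_vi_iff)
    qed
    show "K \<subseteq> closure (range dS)"
      using incr by (fastforce simp: closure_sequential)
  qed
qed

end
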